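(* For mutually distinct $h,i,j,m\in\{0,1,2,3\}$, the Lie subalgebra of the tetrahedron algebra $\boxtimes$ generated by $X_{hi}$ and $X_{jm}$ is isomorphic to the Onsager algebra $\mathcal{O}$.
   Context: $k$ is an arbitrary field of characteristic zero. The tetrahedron algebra $\boxtimes$ is the Lie algebra over $k$ with generators $\{X_{ij}\mid i,j\in\{0,1,2,3\},\ i\neq j\}$ and relations: $X_{ij}+X_{ji}=0$ for $i\ne j$; $[X_{ij},X_{jm}]=2(X_{ij}+X_{jm})$ for mutually distinct $i,j,m$; $[X_{hi},[X_{hi},[X_{hi},X_{jm}]]]=4[X_{hi},X_{jm}]$ for mutually distinct $h,i,j,m$. The Onsager algebra $\mathcal{O}$ is the Lie algebra over $k$ with basis $\{A_n, G_l \mid n\in\mathbb{Z},\ l\in\mathbb{N}_+\}$, where $\mathbb{N}_+=\{1,2,\dots\}$, and antisymmetric bilinear product given by $[A_l,A_n]=2G_{l-n}$ for $l>n$, $[G_l,A_n]=A_{n+l}-A_{n-l}$, $[G_l,G_n]=0$. *)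

theory Defs
  imports Complex_Main "HOL-Library.Poly_Mapping" "HOL-Library.Numeral_Type"
begin

section \<open>Lie algebras\<close>

locale lie_algebra = vector_space scale
  for scale :: "'k::field \<Rightarrow> 'a::ab_group_add \<Rightarrow> 'a" +
  fixes bracket :: "'a \<Rightarrow> 'a \<Rightarrow> 'a"
  assumes bracket_add_left: "bracket (x + y) z = bracket x z + bracket y z"
    and bracket_add_right: "bracket x (y + z) = bracket x y + bracket x z"
    and bracket_scale_left: "bracket (scale c x) y = scale c (bracket x y)"
    and bracket_scale_right: "bracket x (scale c y) = scale c (bracket x y)"
    and bracket_self: "bracket x x = 0"
    and jacobi: "bracket x (bracket y z) + bracket y (bracket z x) + bracket z (bracket x y) = 0"
begin

definition lie_subalgebra :: "'a set \<Rightarrow> bool" where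
  "lie_subalgebra S \<longleftrightarrow> subspace S \<and> (\<forall>x\<in>S. \<forall>y\<in>S. bracket x y \<in> S)"

definition lie_generated :: "'a set \<Rightarrow> 'a set" where
  "lie_generated B = lie_subalgebra hull B"

lemma lie_subalgebra_generated: "lie_subalgebra (lie_generated B)"
  unfolding lie_generated_def
  by (rule hull_in) (auto simp: lie_subalgebra_def subspace_def)

lemma bracket_skew: "bracket x y = - bracket y x"
proof -
  have "bracket (x + y) (x + y) = bracket x x + bracket y x + (bracket x y + bracket y y)"
    by (simp only: bracket_add_left bracket_add_right)
  then have "bracket x y + bracket y x = 0"
    by (simp add: bracket_self add.commute)
  then show ?thesis
    by (simp add: eq_neg_iff_add_eq_0)
qed

end

text \<open>
  \<open>S\<close> and \<open>T\<close> are meant to be Lie subalgebras of the Lie algebras \<open>(s\<^sub>1, b\<^sub>1)\<close> and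
  \<open>(s\<^sub>2, b\<^sub>2)\<close>; a whole Lie algebra is its subalgebra \<open>UNIV\<close>.
\<close>

definition lie_isomorphic ::
  "('k \<Rightarrow> 'a::ab_group_add \<Rightarrow> 'a) \<Rightarrow> ('a \<Rightarrow> 'a \<Rightarrow> 'a) \<Rightarrow> 'a set \<Rightarrow>
   ('k \<Rightarrow> 'b::ab_group_add \<Rightarrow> 'b) \<Rightarrow> ('b \<Rightarrow> 'b \<Rightarrow> 'b) \<Rightarrow> 'b set \<Rightarrow> bool" where
  "lie_isomorphic s1 b1 S s2 b2 T \<longleftrightarrow>
    (\<exists>f. bij_betw f S T \<and>
      (\<forall>x\<in>S. \<forall>y\<in>S. f (x + y) = f x + f y) \<and>
      (\<forall>c. \<forall>x\<in>S. f (s1 c x) = s2 c (f x)) \<and>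
      (\<forall>x\<in>S. \<forall>y\<in>S. f (b1 x y) = b2 (f x) (f y)))"


section \<open>Presentations of Lie algebras\<close>

text \<open>
  The Lie algebra with generators \<open>'g\<close> and relations \<open>R\<close> is the set of formal Lie expressions in
  the generators modulo the least congruence that contains \<open>R\<close> and the Lie algebra axioms.
\<close>

datatype ('k, 'g) lie_term =
    Gen 'g
  | Zero
  | Add "('k, 'g) lie_term" "('k, 'g) lie_term"
  | Neg "('k, 'g) lie_term"
  | Scale 'k "('k, 'g) lie_term"
  | Br "('k, 'g) lie_term" "('k, 'g) lie_term"

inductive lie_cong ::
  "(('k::field, 'g) lie_term \<times> ('k, 'g) lie_term) set \<Rightarrow>
   ('k, 'g) lie_term \<Rightarrow> ('k, 'g) lie_term \<Rightarrow> bool"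
  for R where
  rel: "(s, t) \<in> R \<Longrightarrow> lie_cong R s t"
| refl: "lie_cong R t t"
| sym: "lie_cong R s t \<Longrightarrow> lie_cong R t s"
| trans: "lie_cong R s t \<Longrightarrow> lie_cong R t u \<Longrightarrow> lie_cong R s u"
| Add_cong: "lie_cong R s s' \<Longrightarrow> lie_cong R t t' \<Longrightarrow> lie_cong R (Add s t) (Add s' t')"
| Neg_cong: "lie_cong R t t' \<Longrightarrow> lie_cong R (Neg t) (Neg t')"
| Scale_cong: "lie_cong R t t' \<Longrightarrow> lie_cong R (Scale c t) (Scale c t')"
| Br_cong: "lie_cong R s s' \<Longrightarrow> lie_cong R t t' \<Longrightarrow> lie_cong R (Br s t) (Br s' t')"
| Add_assoc: "lie_cong R (Add (Add s t) u) (Add s (Add t u))"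
| Add_commute: "lie_cong R (Add s t) (Add t s)"
| Add_Zero: "lie_cong R (Add Zero t) t"
| Add_Neg: "lie_cong R (Add (Neg t) t) Zero"
| Scale_Add: "lie_cong R (Scale c (Add s t)) (Add (Scale c s) (Scale c t))"
| Scale_plus: "lie_cong R (Scale (c + d) t) (Add (Scale c t) (Scale d t))"
| Scale_Scale: "lie_cong R (Scale c (Scale d t)) (Scale (c * d) t)"
| Scale_one: "lie_cong R (Scale 1 t) t"
| Br_Add_left: "lie_cong R (Br (Add s t) u) (Add (Br s u) (Br t u))"
| Br_Add_right: "lie_cong R (Br s (Add t u)) (Add (Br s t) (Br s u))"
| Br_Scale_left: "lie_cong R (Br (Scale c s) t) (Scale c (Br s t))"
| Br_Scale_right: "lie_cong R (Br s (Scale c t)) (Scale c (Br s t))"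
| Br_self: "lie_cong R (Br t t) Zero"
| Jacobi: "lie_cong R (Add (Add (Br s (Br t u)) (Br t (Br u s))) (Br u (Br s t))) Zero"

lemma equivp_lie_cong: "equivp (lie_cong R)"
  by (intro equivpI reflpI sympI transpI) (blast intro: lie_cong.intros)+

context lie_algebra
begin

primrec eval_term :: "('g \<Rightarrow> 'a) \<Rightarrow> ('k, 'g) lie_term \<Rightarrow> 'a" where
  "eval_term \<phi> (Gen g) = \<phi> g"
| "eval_term \<phi> Zero = 0"
| "eval_term \<phi> (Add s t) = eval_term \<phi> s + eval_term \<phi> t"
| "eval_term \<phi> (Neg t) = - eval_term \<phi> t"
| "eval_term \<phi> (Scale c t) = scale c (eval_term \<phi> t)"
| "eval_term \<phi> (Br s t) = bracket (eval_term \<phi> s) (eval_term \<phi> t)"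

lemma eval_term_cong:
  assumes "lie_cong R s t" and "\<And>u v. (u, v) \<in> R \<Longrightarrow> eval_term \<phi> u = eval_term \<phi> v"
  shows "eval_term \<phi> s = eval_term \<phi> t"
  using assms
  by induction
    (auto simp: scale_right_distrib scale_left_distrib bracket_add_left bracket_add_right
      bracket_scale_left bracket_scale_right bracket_self jacobi[unfolded add.assoc] add_ac)

end


section \<open>The tetrahedron algebra\<close>

text \<open>The index set \<open>{0, 1, 2, 3}\<close> is the four-element type \<open>4\<close>.\<close>

typedef tet_gen = "{(i :: 4, j :: 4). i \<noteq> j}"
  by (rule exI[of _ "(0, 1)"]) simp

definition tet_X :: "4 \<Rightarrow> 4 \<Rightarrow> ('k, tet_gen) lie_term" where
  "tet_X i j = Gen (Abs_tet_gen (i, j))"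

definition tet_rels :: "(('k::field_char_0, tet_gen) lie_term \<times> ('k, tet_gen) lie_term) set" where
  "tet_rels =
    {(Add (tet_X i j) (tet_X j i), Zero) | i j. i \<noteq> j} \<union>
    {(Br (tet_X i j) (tet_X j m), Scale 2 (Add (tet_X i j) (tet_X j m))) | i j m.
       distinct [i, j, m]} \<union>
    {(Br (tet_X h i) (Br (tet_X h i) (Br (tet_X h i) (tet_X j m))),
      Scale 4 (Br (tet_X h i) (tet_X j m))) | h i j m. distinct [h, i, j, m]}"

quotient_type (overloaded) 'k tetrahedron = "('k::field_char_0, tet_gen) lie_term" /
    "lie_cong tet_rels"
  by (rule equivp_lie_cong)

instantiation tetrahedron :: (field_char_0) ab_group_add
begin

lift_definition zero_tetrahedron :: "'a tetrahedron" is Zero .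
lift_definition plus_tetrahedron :: "'a tetrahedron \<Rightarrow> 'a tetrahedron \<Rightarrow> 'a tetrahedron" is Add
  by (rule lie_cong.Add_cong)
lift_definition uminus_tetrahedron :: "'a tetrahedron \<Rightarrow> 'a tetrahedron" is Neg
  by (rule lie_cong.Neg_cong)
definition minus_tetrahedron :: "'a tetrahedron \<Rightarrow> 'a tetrahedron \<Rightarrow> 'a tetrahedron" where
  "minus_tetrahedron x y = x + - y"

instance
proof
  fix x y z :: "'a tetrahedron"
  show "x + y + z = x + (y + z)" by transfer (rule lie_cong.Add_assoc)
  show "x + y = y + x" by transfer (rule lie_cong.Add_commute)
  show "0 + x = x" by transfer (rule lie_cong.Add_Zero)
  show "- x + x = 0" by transfer (rule lie_cong.Add_Neg)
  show "x - y = x + - y" by (rule minus_tetrahedron_def)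
qed

end

lift_definition tet_scale :: "'k::field_char_0 \<Rightarrow> 'k tetrahedron \<Rightarrow> 'k tetrahedron" is Scale
  by (rule lie_cong.Scale_cong)

lift_definition tet_bracket :: "'k::field_char_0 tetrahedron \<Rightarrow> 'k tetrahedron \<Rightarrow> 'k tetrahedron" is Br
  by (rule lie_cong.Br_cong)

text \<open>\<open>X i i\<close> is a junk value.\<close>

lift_definition X :: "4 \<Rightarrow> 4 \<Rightarrow> 'k::field_char_0 tetrahedron" is tet_X .

interpretation tetrahedron: lie_algebra tet_scale tet_bracket
proof
  fix a b :: "'k::field_char_0" and x y z :: "'k tetrahedron"
  show "tet_scale a (x + y) = tet_scale a x + tet_scale a y"
    by transfer (rule lie_cong.Scale_Add)
  show "tet_scale (a + b) x = tet_scale a x + tet_scale b x"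
    by transfer (rule lie_cong.Scale_plus)
  show "tet_scale a (tet_scale b x) = tet_scale (a * b) x"
    by transfer (rule lie_cong.Scale_Scale)
  show "tet_scale 1 x = x"
    by transfer (rule lie_cong.Scale_one)
  show "tet_bracket (x + y) z = tet_bracket x z + tet_bracket y z"
    by transfer (rule lie_cong.Br_Add_left)
  show "tet_bracket x (y + z) = tet_bracket x y + tet_bracket x z"
    by transfer (rule lie_cong.Br_Add_right)
  show "tet_bracket (tet_scale a x) y = tet_scale a (tet_bracket x y)"
    by transfer (rule lie_cong.Br_Scale_left)
  show "tet_bracket x (tet_scale a y) = tet_scale a (tet_bracket x y)"
    by transfer (rule lie_cong.Br_Scale_right)
  show "tet_bracket x x = 0"
    by transfer (rule lie_cong.Br_self)
  show "tet_bracket x (tet_bracket y z) + tet_bracket y (tet_bracket z x)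
      + tet_bracket z (tet_bracket x y) = 0"
    by transfer (rule lie_cong.Jacobi)
qed

lemma tetrahedron_relations:
  shows "i \<noteq> j \<Longrightarrow> X i j + X j i = 0"
    and "distinct [i, j, m] \<Longrightarrow>
      tet_bracket (X i j) (X j m) = tet_scale 2 (X i j + X j m)"
    and "distinct [h, i, j, m] \<Longrightarrow>
      tet_bracket (X h i) (tet_bracket (X h i) (tet_bracket (X h i) (X j m)))
        = tet_scale 4 (tet_bracket (X h i) (X j m))"
  by (transfer, rule lie_cong.rel, unfold tet_rels_def, blast)+


section \<open>The Onsager algebra\<close>

typedef pos_nat = "{l :: nat. l > 0}"
  by (rule exI[of _ 1]) simp

datatype onsager_index = A_index int | G_index pos_nat

type_synonym 'k onsager = "onsager_index \<Rightarrow>\<^sub>0 'k"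

definition ons_A :: "int \<Rightarrow> 'k::field_char_0 onsager" where
  "ons_A n = Poly_Mapping.single (A_index n) 1"

text \<open>\<open>ons_G 0\<close> is a junk value; the basis consists of the \<open>ons_A n\<close> and the \<open>ons_G l\<close> with \<open>l > 0\<close>.\<close>

definition ons_G :: "nat \<Rightarrow> 'k::field_char_0 onsager" where
  "ons_G l = Poly_Mapping.single (G_index (Abs_pos_nat l)) 1"

definition ons_scale :: "'k::field_char_0 \<Rightarrow> 'k onsager \<Rightarrow> 'k onsager" where
  "ons_scale c = Poly_Mapping.map ((*) c)"

fun ons_basis_bracket :: "onsager_index \<Rightarrow> onsager_index \<Rightarrow> 'k::field_char_0 onsager" where
  "ons_basis_bracket (A_index l) (A_index n) =
    (if l > n then ons_scale 2 (ons_G (nat (l - n)))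
     else if l < n then - ons_scale 2 (ons_G (nat (n - l)))
     else 0)"
| "ons_basis_bracket (G_index l) (A_index n) =
    ons_A (n + int (Rep_pos_nat l)) - ons_A (n - int (Rep_pos_nat l))"
| "ons_basis_bracket (A_index n) (G_index l) =
    - (ons_A (n + int (Rep_pos_nat l)) - ons_A (n - int (Rep_pos_nat l)))"
| "ons_basis_bracket (G_index l) (G_index n) = 0"

definition ons_bracket :: "'k::field_char_0 onsager \<Rightarrow> 'k onsager \<Rightarrow> 'k onsager" where
  "ons_bracket x y =
    (\<Sum>a\<in>Poly_Mapping.keys x. \<Sum>b\<in>Poly_Mapping.keys y.
      ons_scale (Poly_Mapping.lookup x a * Poly_Mapping.lookup y b) (ons_basis_bracket a b))"

lemma lookup_ons_scale [simp]:
  "Poly_Mapping.lookup (ons_scale c x) a = c * Poly_Mapping.lookup x a"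
  unfolding ons_scale_def by (simp add: Poly_Mapping.map.rep_eq when_def)

interpretation onsager_vs: vector_space ons_scale
  by standard (auto intro!: poly_mapping_eqI simp: lookup_add algebra_simps)

lemma ons_bracket_superset:
  assumes "finite S" "finite T" "Poly_Mapping.keys x \<subseteq> S" "Poly_Mapping.keys y \<subseteq> T"
  shows "ons_bracket x y =
    (\<Sum>a\<in>S. \<Sum>b\<in>T.
      ons_scale (Poly_Mapping.lookup x a * Poly_Mapping.lookup y b) (ons_basis_bracket a b))"
proof -
  have "(\<Sum>b\<in>Poly_Mapping.keys y.
      ons_scale (Poly_Mapping.lookup x a * Poly_Mapping.lookup y b) (ons_basis_bracket a b)) =
    (\<Sum>b\<in>T. ons_scale (Poly_Mapping.lookup x a * Poly_Mapping.lookup y b) (ons_basis_bracket a b))"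
    for a
    using assms by (intro sum.mono_neutral_left) (auto simp: in_keys_iff)
  then have "ons_bracket x y = (\<Sum>a\<in>Poly_Mapping.keys x. \<Sum>b\<in>T.
      ons_scale (Poly_Mapping.lookup x a * Poly_Mapping.lookup y b) (ons_basis_bracket a b))"
    by (simp add: ons_bracket_def)
  also have "\<dots> = (\<Sum>a\<in>S. \<Sum>b\<in>T.
      ons_scale (Poly_Mapping.lookup x a * Poly_Mapping.lookup y b) (ons_basis_bracket a b))"
    using assms by (intro sum.mono_neutral_left) (auto simp: in_keys_iff intro!: sum.neutral)
  finally show ?thesis .
qed

lemma ons_bracket_single:
  "ons_bracket (Poly_Mapping.single a c) (Poly_Mapping.single b d) =
    ons_scale (c * d) (ons_basis_bracket a b)"
  by (subst ons_bracket_superset[of "{a}" "{b}"]) auto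

lemma ons_bracket_add_left: "ons_bracket (x + y) z = ons_bracket x z + ons_bracket y z"
proof -
  let ?S = "Poly_Mapping.keys x \<union> Poly_Mapping.keys y" and ?T = "Poly_Mapping.keys z"
  have "Poly_Mapping.keys (x + y) \<subseteq> ?S" by (rule Poly_Mapping.keys_add)
  then show ?thesis
    by (simp add: ons_bracket_superset[of ?S ?T] lookup_add distrib_right
        onsager_vs.scale_left_distrib sum.distrib)
qed

lemma ons_bracket_add_right: "ons_bracket x (y + z) = ons_bracket x y + ons_bracket x z"
proof -
  let ?S = "Poly_Mapping.keys x" and ?T = "Poly_Mapping.keys y \<union> Poly_Mapping.keys z"
  have "Poly_Mapping.keys (y + z) \<subseteq> ?T" by (rule Poly_Mapping.keys_add)
  then show ?thesis
    by (simp add: ons_bracket_superset[of ?S ?T] lookup_add distrib_left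
        onsager_vs.scale_left_distrib sum.distrib)
qed

lemma keys_ons_scale: "Poly_Mapping.keys (ons_scale c x) \<subseteq> Poly_Mapping.keys x"
  by (auto simp: in_keys_iff)

lemma ons_bracket_scale_left: "ons_bracket (ons_scale c x) y = ons_scale c (ons_bracket x y)"
  by (simp add: ons_bracket_superset[of "Poly_Mapping.keys x" "Poly_Mapping.keys y"] keys_ons_scale
      onsager_vs.scale_sum_right mult.assoc)

lemma ons_bracket_scale_right: "ons_bracket x (ons_scale c y) = ons_scale c (ons_bracket x y)"
  by (simp add: ons_bracket_superset[of "Poly_Mapping.keys x" "Poly_Mapping.keys y"] keys_ons_scale
      onsager_vs.scale_sum_right mult_ac)

lemma onsager_induct [case_names zero add]:
  assumes "P 0" and "\<And>a c x. P x \<Longrightarrow> P (Poly_Mapping.single a c + x)"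
  shows "P (x :: 'k::field_char_0 onsager)"
proof (induction "card (Poly_Mapping.keys x)" arbitrary: x)
  case 0
  then have "x = 0" by (auto intro!: poly_mapping_eqI simp: in_keys_iff)
  then show ?case using assms(1) by simp
next
  case (Suc n)
  then obtain a where a: "a \<in> Poly_Mapping.keys x"
    by (metis card.empty equals0I nat.distinct(1))
  define y where "y = x - Poly_Mapping.single a (Poly_Mapping.lookup x a)"
  have "Poly_Mapping.keys y = Poly_Mapping.keys x - {a}"
    by (auto simp: y_def in_keys_iff lookup_minus lookup_single when_def split: if_splits)
  then have "P y" using Suc a by (intro Suc(1)) simp
  then have "P (Poly_Mapping.single a (Poly_Mapping.lookup x a) + y)" by (rule assms(2))
  then show ?case by (simp add: y_def)
qed

text \<open>The convention \<open>G\<^sub>0 = 0\<close> and \<open>G\<^bsub>-l\<^esub> = - G\<^sub>l\<close>, which makes the bracket formulas uniform.\<close>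

definition ons_G_int :: "int \<Rightarrow> 'k::field_char_0 onsager" where
  "ons_G_int l = (if l > 0 then ons_G (nat l) else if l < 0 then - ons_G (nat (- l)) else 0)"

lemma ons_scale_basis: "ons_scale c (Poly_Mapping.single a d) = Poly_Mapping.single a (c * d)"
  by (auto intro!: poly_mapping_eqI simp: lookup_single when_def)

lemma ons_bracket_A_A: "ons_bracket (ons_A l) (ons_A n) = ons_scale 2 (ons_G_int (l - n))"
  by (auto simp: ons_A_def ons_bracket_single ons_G_int_def)

lemma ons_bracket_uminus_left: "ons_bracket (- x) y = - ons_bracket x y"
  using ons_bracket_scale_left[of "- 1" x y] by simp

lemma ons_bracket_uminus_right: "ons_bracket x (- y) = - ons_bracket x y"
  using ons_bracket_scale_right[of x "- 1" y] by simp

lemma ons_bracket_zero [simp]: "ons_bracket 0 x = 0" "ons_bracket x 0 = 0"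
  by (simp_all add: ons_bracket_def)

lemma ons_bracket_Gnat_A:
  "l > 0 \<Longrightarrow> ons_bracket (ons_G l) (ons_A n) = ons_A (n + int l) - ons_A (n - int l)"
  "l > 0 \<Longrightarrow> ons_bracket (ons_A n) (ons_G l) = ons_A (n - int l) - ons_A (n + int l)"
  by (simp_all add: ons_bracket_single ons_A_def ons_G_def Abs_pos_nat_inverse)

lemma ons_bracket_G_A:
  "ons_bracket (ons_G_int l) (ons_A n) = ons_A (n + l) - ons_A (n - l)"
  "ons_bracket (ons_A n) (ons_G_int l) = ons_A (n - l) - ons_A (n + l)"
  by (auto simp: ons_G_int_def ons_bracket_Gnat_A ons_bracket_uminus_left ons_bracket_uminus_right)

lemma ons_bracket_G_G: "ons_bracket (ons_G_int l) (ons_G_int n) = 0"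
  by (auto simp: ons_G_int_def ons_G_def ons_bracket_single
      ons_bracket_uminus_left ons_bracket_uminus_right)

lemma onsager_products:
  shows "l > n \<Longrightarrow> ons_bracket (ons_A l) (ons_A n) = ons_scale 2 (ons_G (nat (l - n)))"
    and "p > 0 \<Longrightarrow> ons_bracket (ons_G p) (ons_A n) = ons_A (n + int p) - ons_A (n - int p)"
    and "ons_bracket (ons_G p) (ons_G q) = 0"
  by (simp_all add: ons_bracket_A_A ons_G_int_def ons_bracket_Gnat_A)
    (simp add: ons_G_def ons_bracket_single)

lemma ons_basis_cases:
  obtains n where "Poly_Mapping.single a c = ons_scale c (ons_A n)"
  | l where "Poly_Mapping.single a c = ons_scale c (ons_G_int l)"
proof (cases a)
  case (A_index n)
  then show ?thesis using that(1)[of n] by (simp add: ons_A_def ons_scale_basis)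
next
  case (G_index l)
  then show ?thesis using that(2)[of "int (Rep_pos_nat l)"] Rep_pos_nat[of l]
    by (simp add: ons_G_int_def ons_G_def ons_scale_basis Rep_pos_nat_inverse)
qed

lemma ons_G_int_uminus: "ons_G_int (- l) = - ons_G_int l"
  by (auto simp: ons_G_int_def)

lemma ons_bracket_skew: "ons_bracket x y = - ons_bracket y x"
proof (induction x rule: onsager_induct)
  case zero
  show ?case by simp
next
  case (add a c x)
  have "ons_bracket (Poly_Mapping.single a c) y = - ons_bracket y (Poly_Mapping.single a c)"
  proof (induction y rule: onsager_induct)
    case zero
    show ?case by simp
  next
    case (add b d y)
    have "ons_bracket (Poly_Mapping.single a c) (Poly_Mapping.single b d)
        = - ons_bracket (Poly_Mapping.single b d) (Poly_Mapping.single a c)"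
      by (simp add: ons_bracket_single, cases a; cases b) (simp_all add: mult.commute onsager_vs.scale_right_diff_distrib)
    with add show ?case
      by (simp add: ons_bracket_add_left ons_bracket_add_right)
  qed
  with add show ?case
    by (simp add: ons_bracket_add_left ons_bracket_add_right)
qed

lemma ons_bracket_self: "ons_bracket x x = 0"
proof -
  have "Poly_Mapping.lookup (ons_bracket x x) a = - Poly_Mapping.lookup (ons_bracket x x) a" for a
    using ons_bracket_skew[of x x] by (metis lookup_uminus)
  then show ?thesis
    by (auto intro!: poly_mapping_eqI)
qed

lemma ons_bracket_diff_right: "ons_bracket x (y - z) = ons_bracket x y - ons_bracket x z"
  using ons_bracket_add_right[of x y "- z"] by (simp add: ons_bracket_uminus_right)

definition ons_jacobiator :: "'k::field_char_0 onsager \<Rightarrow> 'k onsager \<Rightarrow> 'k onsager \<Rightarrow> 'k onsager" where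
  "ons_jacobiator x y z =
    ons_bracket x (ons_bracket y z) + ons_bracket y (ons_bracket z x) + ons_bracket z (ons_bracket x y)"

lemma ons_jacobiator_cyclic: "ons_jacobiator x y z = ons_jacobiator y z x"
  by (simp add: ons_jacobiator_def add_ac)

lemma ons_jacobiator_basis:
  "ons_jacobiator (ons_A l) (ons_A m) (ons_A n) = (0 :: 'k::field_char_0 onsager)"
  "ons_jacobiator (ons_A l) (ons_A m) (ons_G_int p) = (0 :: 'k onsager)"
  "ons_jacobiator (ons_A l) (ons_G_int p) (ons_G_int q) = (0 :: 'k onsager)"
  "ons_jacobiator (ons_G_int p) (ons_G_int q) (ons_G_int r) = (0 :: 'k onsager)"
proof -
  have "ons_A (l - (m - n)) - ons_A (l + (m - n)) + (ons_A (m - (n - l)) - ons_A (m + (n - l)))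
      + (ons_A (n - (l - m)) - ons_A (n + (l - m))) = (0 :: 'k onsager)"
    by (simp add: algebra_simps)
  then show "ons_jacobiator (ons_A l) (ons_A m) (ons_A n) = (0 :: 'k onsager)"
    by (simp add: ons_jacobiator_def ons_bracket_A_A ons_bracket_scale_right ons_bracket_G_A
        flip: onsager_vs.scale_right_distrib)
  have "ons_G_int (m - (l + p)) = - (ons_G_int (l - (m - p)) :: 'k onsager)"
    "ons_G_int (m - (l - p)) = - (ons_G_int (l - (m + p)) :: 'k onsager)"
    using ons_G_int_uminus[of "l - (m - p)", where 'a = 'k] ons_G_int_uminus[of "l - (m + p)", where 'a = 'k]
    by (simp_all add: algebra_simps)
  then show "ons_jacobiator (ons_A l) (ons_A m) (ons_G_int p) = (0 :: 'k onsager)"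
    by (simp add: ons_jacobiator_def ons_bracket_A_A ons_bracket_G_A ons_bracket_G_G
        ons_bracket_diff_right ons_bracket_scale_right)
  show "ons_jacobiator (ons_A l) (ons_G_int p) (ons_G_int q) = (0 :: 'k onsager)"
    by (simp add: ons_jacobiator_def ons_bracket_G_A ons_bracket_G_G ons_bracket_diff_right
        algebra_simps)
  show "ons_jacobiator (ons_G_int p) (ons_G_int q) (ons_G_int r) = (0 :: 'k onsager)"
    by (simp add: ons_jacobiator_def ons_bracket_G_G)
qed

lemma ons_jacobiator_single:
  "ons_jacobiator (Poly_Mapping.single a c) (Poly_Mapping.single b d) (Poly_Mapping.single e k) = 0"
proof -
  have scale: "ons_jacobiator (ons_scale c x) (ons_scale d y) (ons_scale k z)
      = ons_scale (c * d * k) (ons_jacobiator x y z)" for x y z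
    by (simp add: ons_jacobiator_def ons_bracket_scale_left ons_bracket_scale_right
        onsager_vs.scale_right_distrib mult_ac)
  have cyc: "ons_jacobiator (ons_A l) (ons_G_int p) (ons_A m) = 0"
    "ons_jacobiator (ons_G_int p) (ons_A l) (ons_A m) = 0"
    "ons_jacobiator (ons_G_int p) (ons_A l) (ons_G_int q) = 0"
    "ons_jacobiator (ons_G_int p) (ons_G_int q) (ons_A l) = 0" for l m p q
    by (metis ons_jacobiator_basis ons_jacobiator_cyclic)+
  show ?thesis
    by (cases rule: ons_basis_cases[of a c]; cases rule: ons_basis_cases[of b d];
        cases rule: ons_basis_cases[of e k])
      (simp_all add: scale ons_jacobiator_basis cyc)
qed

lemma ons_jacobiator_add: "ons_jacobiator (x + x') y z = ons_jacobiator x y z + ons_jacobiator x' y z"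
  by (simp add: ons_jacobiator_def ons_bracket_add_left ons_bracket_add_right add_ac)

lemma ons_jacobiator_zero: "ons_jacobiator 0 y z = 0"
  by (simp add: ons_jacobiator_def)

lemma ons_jacobiator_eq_0: "ons_jacobiator x y z = 0"
proof -
  have 1: "ons_jacobiator x (Poly_Mapping.single b d) (Poly_Mapping.single e k) = 0" for x b d e k
    by (induction x rule: onsager_induct)
      (simp_all add: ons_jacobiator_zero ons_jacobiator_add ons_jacobiator_single)
  have 2: "ons_jacobiator y (Poly_Mapping.single e k) x = 0" for x y e k
    by (induction y rule: onsager_induct)
      (simp_all add: ons_jacobiator_zero ons_jacobiator_add,
        metis 1 ons_jacobiator_cyclic)
  have "ons_jacobiator z x y = 0"
    by (induction z rule: onsager_induct)
      (simp_all add: ons_jacobiator_zero ons_jacobiator_add, metis 2 ons_jacobiator_cyclic)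
  then show ?thesis
    by (metis ons_jacobiator_cyclic)
qed

interpretation onsager: lie_algebra ons_scale ons_bracket
  by standard
    (simp_all add: ons_bracket_add_left ons_bracket_add_right ons_bracket_scale_left
      ons_bracket_scale_right ons_bracket_self ons_jacobiator_eq_0[unfolded ons_jacobiator_def])

end

theory Submission
  imports Defs "HOL-Computational_Algebra.Formal_Laurent_Series" "HOL-Library.Product_Plus"
begin

text \<open>
  The elements \<open>A = X\<^bsub>hi\<^esub>\<close> and \<open>B = X\<^bsub>jm\<^esub>\<close> for two opposite edges form a \<^emph>\<open>Dolan--Grady pair\<close>:
  \<open>[A, [A, [A, B]]] = 4 [A, B]\<close> and \<open>[B, [B, [B, A]]] = 4 [B, A]\<close>. The isomorphism is the inverse of the
  homomorphism from the Onsager algebra that sends \<open>A\<^sub>0\<close> to \<open>A\<close> and \<open>A\<^sub>1\<close> to \<open>B\<close>. Its range is the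
  subalgebra generated by \<open>A\<close> and \<open>B\<close> (\<open>range_onsager_map\<close>); it has to be shown that it exists and
  is injective.

  Existence is a theorem about any Dolan--Grady pair in a Lie algebra of characteristic zero. On the
  subalgebra generated by \<open>A\<close> and \<open>B\<close> the eigenvalues of \<open>ad A\<close> are even integers. The sign change on
  the eigenspaces whose eigenvalue is not divisible by 4 respects brackets, fixes \<open>A\<close>, and sends \<open>B\<close>
  to \<open>B - [A, [A, B]] / 2\<close>. So this element forms a Dolan--Grady pair with \<open>A\<close> as well
  (\<open>dolan_grady_reflect\<close>). Iteration in both directions yields a sequence \<open>a\<^sub>n\<close> with constant bracket
  \<open>[a\<^bsub>n+1\<^esub>, a\<^sub>n] = 2 g\<^sub>1\<close> and \<open>[g\<^sub>1, a\<^sub>n] = a\<^bsub>n+1\<^esub> - a\<^bsub>n-1\<^esub>\<close>. All relations of the Onsager algebra follow by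
  induction on the distance \<open>l\<close> of the indices. The crucial point is \<open>[g\<^sub>1, g\<^sub>l] = 0\<close>
  (\<open>g1_commutes_step\<close>): computing the bracket with either factor as a derivation gives
  \<open>(l + 1) [g\<^sub>1, g\<^sub>l] = 0\<close>.

  Injectivity comes from a representation of the tetrahedron algebra. Attach distinct points to
  the four vertices, and send \<open>X\<^bsub>bc\<^esub>\<close> to the quadratic vector field that vanishes at the points of
  \<open>b\<close> and \<open>c\<close>, suitably normalised. For the points \<open>1, -1, t, -t\<close> over Laurent series in \<open>t\<close>, the
  elements \<open>a\<^sub>n\<close> and \<open>g\<^sub>l\<close> go to \<open>(t\<^sup>n - t\<^bsup>-n\<^esup> z\<^sup>2) d/dz\<close> and \<open>(t\<^bsup>-l\<^esup> - t\<^sup>l) z d/dz\<close>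
  (\<open>tetrahedron_to_loop\<close>), from which every coordinate in the Onsager basis can be read off.
\<close>

section \<open>Lie algebras in characteristic zero\<close>

locale lie_algebra_char_0 = lie_algebra scale bracket
  for scale :: "'k::field_char_0 \<Rightarrow> 'a::ab_group_add \<Rightarrow> 'a"
    and bracket :: "'a \<Rightarrow> 'a \<Rightarrow> 'a"
begin

lemma bracket_zero_left [simp]: "bracket 0 x = 0"
  using bracket_scale_left[of 0 0 x] by simp

lemma bracket_zero_right [simp]: "bracket x 0 = 0"
  using bracket_scale_right[of x 0 0] by simp

lemma bracket_minus_left: "bracket (- x) y = - bracket x y"
  using bracket_scale_left[of "- 1" x y] by simp

lemma bracket_minus_right: "bracket x (- y) = - bracket x y"
  using bracket_scale_right[of x "- 1" y] by simp

lemma bracket_diff_left: "bracket (x - y) z = bracket x z - bracket y z"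
  using bracket_add_left[of x "- y" z] by (simp add: bracket_minus_left)

lemma bracket_diff_right: "bracket x (y - z) = bracket x y - bracket x z"
  using bracket_add_right[of x y "- z"] by (simp add: bracket_minus_right)

lemmas bracket_linear = bracket_add_left bracket_add_right bracket_diff_left bracket_diff_right
  bracket_minus_left bracket_minus_right bracket_scale_left bracket_scale_right

lemma bracket_sum_right: "bracket x (\<Sum>i\<in>I. f i) = (\<Sum>i\<in>I. bracket x (f i))"
  by (induction I rule: infinite_finite_induct) (simp_all add: bracket_add_right)

lemma bracket_derivation:
  "bracket x (bracket y z) = bracket (bracket x y) z + bracket y (bracket x z)"
proof -
  have "bracket x (bracket y z) = - bracket y (bracket z x) - bracket z (bracket x y)"
    using jacobi[of x y z] by (simp add: algebra_simps eq_neg_iff_add_eq_0)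
  also have "\<dots> = bracket y (bracket x z) + bracket (bracket x y) z"
    using bracket_skew[of z x] bracket_skew[of z "bracket x y"] by (simp add: bracket_linear)
  finally show ?thesis by (simp add: add.commute)
qed

lemma scale_two: "scale 2 x = x + x"
  using scale_left_distrib[of 1 1 x] by simp

lemma scale_cancel_of_nat: "scale (of_nat (Suc n)) x = 0 \<Longrightarrow> x = 0"
  by (metis scale_eq_0_iff of_nat_eq_0_iff nat.distinct(2))

section \<open>Eigenvectors of an inner derivation\<close>

definition weight_sum :: "'a \<Rightarrow> 'k set \<Rightarrow> 'a set" where
  "weight_sum A C = span {x. \<exists>c\<in>C. bracket A x = scale c x}"

lemma weight_vector_in_weight_sum:
  "bracket A x = scale c x \<Longrightarrow> c \<in> C \<Longrightarrow> x \<in> weight_sum A C"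
  unfolding weight_sum_def by (rule span_base) auto

lemma weight_sum_add: "x \<in> weight_sum A C \<Longrightarrow> y \<in> weight_sum A C \<Longrightarrow> x + y \<in> weight_sum A C"
  and weight_sum_diff: "x \<in> weight_sum A C \<Longrightarrow> y \<in> weight_sum A C \<Longrightarrow> x - y \<in> weight_sum A C"
  and weight_sum_scale: "x \<in> weight_sum A C \<Longrightarrow> scale c x \<in> weight_sum A C"
  and weight_sum_minus: "x \<in> weight_sum A C \<Longrightarrow> - x \<in> weight_sum A C"
  unfolding weight_sum_def by (blast intro: span_add span_diff span_scale span_neg)+

text \<open>Since \<open>ad A\<close> is a derivation, eigenvalues add under the bracket.\<close>

lemma weight_sum_bracket:
  assumes CD: "\<And>c d. c \<in> C \<Longrightarrow> d \<in> D \<Longrightarrow> c + d \<in> E"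
    and x: "x \<in> weight_sum A C" and y: "y \<in> weight_sum A D"
  shows "bracket x y \<in> weight_sum A E"
proof -
  have vec: "bracket x y \<in> weight_sum A E"
    if "bracket A x = scale c x" "c \<in> C" "bracket A y = scale d y" "d \<in> D" for x y c d
  proof (rule weight_vector_in_weight_sum[of _ _ "c + d"])
    show "bracket A (bracket x y) = scale (c + d) (bracket x y)"
      by (simp add: bracket_derivation[of A x y] that bracket_linear scale_left_distrib)
  qed (simp add: CD that)
  have half: "bracket x y \<in> weight_sum A E" if xc: "bracket A x = scale c x" "c \<in> C" for x c
    using y unfolding weight_sum_def[of A D]
  proof (induction rule: span_induct_alt)
    case base
    show ?case by (simp add: weight_sum_def span_zero)
  next
    case (step r z y)
    then show ?case using vec[OF xc]
      by (auto simp: bracket_linear intro!: weight_sum_add weight_sum_scale)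
  qed
  show ?thesis using x unfolding weight_sum_def[of A C]
  proof (induction rule: span_induct_alt)
    case base
    show ?case by (simp add: weight_sum_def span_zero)
  next
    case (step r z x)
    then show ?case using half
      by (auto simp: bracket_linear intro!: weight_sum_add weight_sum_scale)
  qed
qed

text \<open>
  The usual elimination: subtracting \<open>d\<close> times the relation from its image under \<open>ad A\<close> removes the
  summand of eigenvalue \<open>d\<close> and scales the others by nonzero factors.
\<close>

lemma weight_vectors_independent:
  assumes "finite F" and "\<And>c. c \<in> F \<Longrightarrow> bracket A (f c) = scale c (f c)"
    and "(\<Sum>c\<in>F. f c) = 0" and "c \<in> F"
  shows "f c = 0"
  using assms
proof (induction F arbitrary: f c rule: finite_induct)
  case empty
  then show ?case by simp
next
  case (insert d F)
  have sum0: "f d + (\<Sum>c\<in>F. f c) = 0" using insert.prems(2) insert.hyps by simp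
  have ad_sum: "bracket A (\<Sum>c\<in>F. f c) = (\<Sum>c\<in>F. scale c (f c))"
    using insert.prems(1) by (simp add: bracket_sum_right)
  have "bracket A (f d + (\<Sum>c\<in>F. f c)) = scale d (f d) + (\<Sum>c\<in>F. scale c (f c))"
    using insert.prems(1) by (simp add: bracket_linear ad_sum)
  then have 1: "scale d (f d) + (\<Sum>c\<in>F. scale c (f c)) = 0" by (simp add: sum0)
  have 2: "scale d (f d) + (\<Sum>c\<in>F. scale d (f c)) = 0"
    using arg_cong[OF sum0, of "scale d"] by (simp add: scale_right_distrib scale_sum_right)
  have "(\<Sum>c\<in>F. scale (c - d) (f c)) = 0"
    using add_left_imp_eq[OF HOL.trans[OF 1 2[symmetric]]]
    by (simp add: scale_left_diff_distrib sum_subtractf)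
  moreover have "bracket A (scale (c - d) (f c)) = scale c (scale (c - d) (f c))" if "c \<in> F" for c
    using that insert.prems(1)[of c] by (simp only: bracket_scale_right scale_left_commute insertI2)
  ultimately have "scale (c - d) (f c) = 0" if "c \<in> F" for c
    using insert.IH[of "\<lambda>c. scale (c - d) (f c)"] that by blast
  then have F0: "f c = 0" if "c \<in> F" for c
    using that insert.hyps(2) by fastforce
  then have "f d = 0" using sum0 by simp
  with F0 insert.prems show ?case by auto
qed

lemma weight_sum_expand:
  assumes "x \<in> weight_sum A C"
  obtains F f where "finite F" "F \<subseteq> C" "\<And>c. bracket A (f c) = scale c (f c)" "x = (\<Sum>c\<in>F. f c)"
proof -
  have "\<exists>F f. finite F \<and> F \<subseteq> C \<and> (\<forall>c. bracket A (f c) = scale c (f c)) \<and> x = (\<Sum>c\<in>F. f c)"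
    using assms unfolding weight_sum_def
  proof (induction rule: span_induct_alt)
    case base
    show ?case by (rule exI[of _ "{}"], rule exI[of _ "\<lambda>_. 0"]) simp
  next
    case (step r z x)
    then obtain c F f where c: "c \<in> C" "bracket A z = scale c z"
      and F: "finite F" "F \<subseteq> C" "\<And>c. bracket A (f c) = scale c (f c)" "x = (\<Sum>c\<in>F. f c)"
      by auto
    define g where "g d = (if d \<in> F then f d else 0) + (if d = c then scale r z else 0)" for d
    have "scale r z + x = (\<Sum>d\<in>insert c F. g d)"
      unfolding g_def sum.distrib using F(1)
      by (simp add: F(4) add.commute sum.If_cases Int_insert_left insert_absorb
          if_distrib[of "\<lambda>u. _ + u"])
    moreover have "bracket A (g d) = scale d (g d)" for d
      using F(3)[of d] c(2) by (auto simp: g_def bracket_linear scale_right_distrib scale_left_commute)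
    ultimately show ?case using c F by (intro exI[of _ "insert c F"] exI[of _ g]) auto
  qed
  then show ?thesis using that by blast
qed

lemma weight_sum_disjoint:
  assumes "x \<in> weight_sum A C" and "x \<in> weight_sum A D" and "C \<inter> D = {}"
  shows "x = 0"
proof -
  obtain F f where F: "finite F" "F \<subseteq> C" "\<And>c. bracket A (f c) = scale c (f c)" "x = (\<Sum>c\<in>F. f c)"
    using weight_sum_expand[OF assms(1)] by blast
  obtain G g where G: "finite G" "G \<subseteq> D" "\<And>c. bracket A (g c) = scale c (g c)" "x = (\<Sum>c\<in>G. g c)"
    using weight_sum_expand[OF assms(2)] by blast
  have dis: "F \<inter> G = {}" using F G assms(3) by blast
  define e where "e c = (if c \<in> F then f c else - g c)" for c
  have "(\<Sum>c\<in>F \<union> G. e c) = (\<Sum>c\<in>F. e c) + (\<Sum>c\<in>G. e c)"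
    using F G dis by (intro sum.union_disjoint) auto
  also have "(\<Sum>c\<in>F. e c) = x" by (simp add: e_def F)
  also have "(\<Sum>c\<in>G. e c) = (\<Sum>c\<in>G. - g c)" using dis by (intro sum.cong) (auto simp: e_def)
  finally have "(\<Sum>c\<in>F \<union> G. e c) = 0" using G(4) by (simp add: sum_negf)
  then have "e c = 0" if "c \<in> F" for c
    using that F G by (intro weight_vectors_independent[of "F \<union> G" A e]) (auto simp: e_def bracket_linear)
  then show ?thesis by (simp add: F(4) e_def)
qed

section \<open>Dolan--Grady pairs and their reflections\<close>

definition dolan_grady :: "'a \<Rightarrow> 'a \<Rightarrow> bool" where
  "dolan_grady A B \<longleftrightarrow>
    bracket A (bracket A (bracket A B)) = scale 4 (bracket A B) \<and>
    bracket B (bracket B (bracket B A)) = scale 4 (bracket B A)"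

text \<open>
  In the Onsager algebra this sends \<open>A\<^sub>n, A\<^bsub>n-1\<^esub>\<close> to \<open>A\<^bsub>n+1\<^esub>\<close>. If \<open>B\<close> splits into eigenvectors of \<open>ad A\<close>
  for the eigenvalues \<open>0, 2, -2\<close>, it changes the sign of the parts for \<open>2\<close> and \<open>-2\<close>; formally it is
  \<open>exp (\<pi> \<i> / 2 \<cdot> ad A)\<close>.
\<close>

definition reflect :: "'a \<Rightarrow> 'a \<Rightarrow> 'a" where
  "reflect A B = B - scale (1/2) (bracket A (bracket A B))"

lemma dolan_grady_sym: "dolan_grady A B \<Longrightarrow> dolan_grady B A"
  by (simp add: dolan_grady_def)

lemma bracket_reflect:
  assumes "dolan_grady A B"
  shows "bracket A (reflect A B) = bracket B A"
proof -
  have "bracket A (reflect A B) = - bracket A B"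
    using assms by (simp add: reflect_def dolan_grady_def bracket_linear scale_two)
  then show ?thesis using bracket_skew[of B A] by simp
qed

lemma reflect_reflect:
  assumes "dolan_grady A B"
  shows "reflect A (reflect A B) = B"
proof -
  have "bracket A (bracket A (reflect A B)) = - bracket A (bracket A B)"
    by (simp add: bracket_reflect[OF assms] bracket_skew[of B A] bracket_minus_right)
  then have "reflect A (reflect A B) = reflect A B + scale (1/2) (bracket A (bracket A B))"
    by (simp add: reflect_def[of A "reflect A B"])
  then show ?thesis by (simp add: reflect_def)
qed

text \<open>
  The elements \<open>A\<close> and \<open>B\<close> of a Dolan--Grady pair generate an algebra in which \<open>ad A\<close> has only even
  integers as eigenvalues. Halving them modulo 2 gives a grading by parity.
\<close>

definition even_part :: "'a \<Rightarrow> 'a set" where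
  "even_part A = weight_sum A (range (\<lambda>n::int. of_int (4 * n)))"

definition odd_part :: "'a \<Rightarrow> 'a set" where
  "odd_part A = weight_sum A (range (\<lambda>n::int. of_int (4 * n + 2)))"

lemma commuting_in_even_part: "bracket A x = 0 \<Longrightarrow> x \<in> even_part A"
  unfolding even_part_def
  by (rule weight_vector_in_weight_sum[of _ _ 0]) (auto intro: range_eqI[of _ _ 0])

lemma bracket_even_even: "x \<in> even_part A \<Longrightarrow> y \<in> even_part A \<Longrightarrow> bracket x y \<in> even_part A"
proof (unfold even_part_def, rule weight_sum_bracket)
  show "c + d \<in> range (\<lambda>n::int. of_int (4 * n))"
    if cd: "c \<in> range (\<lambda>n::int. of_int (4 * n))" "d \<in> range (\<lambda>n::int. of_int (4 * n))" for c d :: 'k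
  proof -
    obtain m n where "c = of_int (4 * m)" "d = of_int (4 * n)" using cd by blast
    then have "c + d = of_int (4 * (m + n))" by simp
    then show ?thesis by blast
  qed
qed

lemma bracket_even_odd: "x \<in> even_part A \<Longrightarrow> y \<in> odd_part A \<Longrightarrow> bracket x y \<in> odd_part A"
proof (unfold even_part_def odd_part_def, rule weight_sum_bracket)
  show "c + d \<in> range (\<lambda>n::int. of_int (4 * n + 2))"
    if cd: "c \<in> range (\<lambda>n::int. of_int (4 * n))" "d \<in> range (\<lambda>n::int. of_int (4 * n + 2))" for c d :: 'k
  proof -
    obtain m n where "c = of_int (4 * m)" "d = of_int (4 * n + 2)" using cd by blast
    then have "c + d = of_int (4 * (m + n) + 2)" by simp
    then show ?thesis by blast
  qed
qed

lemma bracket_odd_odd: "x \<in> odd_part A \<Longrightarrow> y \<in> odd_part A \<Longrightarrow> bracket x y \<in> even_part A"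
proof (unfold even_part_def odd_part_def, rule weight_sum_bracket)
  show "c + d \<in> range (\<lambda>n::int. of_int (4 * n))"
    if cd: "c \<in> range (\<lambda>n::int. of_int (4 * n + 2))" "d \<in> range (\<lambda>n::int. of_int (4 * n + 2))" for c d :: 'k
  proof -
    obtain m n where "c = of_int (4 * m + 2)" "d = of_int (4 * n + 2)" using cd by blast
    then have "c + d = of_int (4 * (m + n + 1))" by simp
    then show ?thesis by blast
  qed
qed

lemma bracket_odd_even: "x \<in> odd_part A \<Longrightarrow> y \<in> even_part A \<Longrightarrow> bracket x y \<in> odd_part A"
  using bracket_even_odd[of y A x] bracket_skew[of x y]
  by (simp add: odd_part_def weight_sum_minus)

lemma even_odd_disjoint:
  assumes "x \<in> even_part A" "x \<in> odd_part A"
  shows "x = 0"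
proof (rule weight_sum_disjoint)
  have "4 * m \<noteq> 4 * n + 2" for m n :: int by presburger
  then show "range (\<lambda>n::int. of_int (4 * n) :: 'k) \<inter> range (\<lambda>n::int. of_int (4 * n + 2)) = {}"
    by (auto simp del: of_int_add of_int_mult)
qed (use assms in \<open>simp_all add: even_part_def odd_part_def\<close>)

text \<open>
  By the cubic relation, \<open>t (t - 2) (t + 2)\<close> annihilates \<open>B\<close> when \<open>t\<close> acts as \<open>ad A\<close>, so \<open>B\<close> is a sum
  of eigenvectors for \<open>0, 2, -2\<close>. They are found by interpolation, \<open>p\<close> and \<open>q\<close> being those for
  \<open>2\<close> and \<open>-2\<close>.
\<close>

lemma even_odd_decomposition:
  assumes "bracket A (bracket A (bracket A B)) = scale 4 (bracket A B)"
  obtains e r where "bracket A e = 0" "r \<in> odd_part A" "B = e + r" "reflect A B = e - r"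
proof
  define r where "r = scale (1/4) (bracket A (bracket A B))"
  define p where "p = scale (1/8) (bracket A (bracket A B) + scale 2 (bracket A B))"
  define q where "q = scale (1/8) (bracket A (bracket A B) - scale 2 (bracket A B))"
  show "bracket A (B - r) = 0"
    by (simp add: r_def bracket_linear assms)
  have "bracket A p = scale 2 p" "bracket A q = scale (-2) q"
    by (simp_all add: p_def q_def bracket_linear assms scale_right_distrib scale_right_diff_distrib
        scale_minus_left algebra_simps)
  moreover have "2 \<in> range (\<lambda>n::int. of_int (4 * n + 2) :: 'k)"
    "- 2 \<in> range (\<lambda>n::int. of_int (4 * n + 2) :: 'k)"
    by (rule range_eqI[of _ _ 0], simp) (rule range_eqI[of _ _ "- 1"], simp)
  ultimately have "p \<in> odd_part A" "q \<in> odd_part A"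
    unfolding odd_part_def by (blast intro: weight_vector_in_weight_sum)+
  moreover have "r = p + q"
    by (simp add: r_def p_def q_def scale_right_distrib[symmetric] scale_two[symmetric])
  ultimately show "r \<in> odd_part A"
    by (simp add: odd_part_def weight_sum_add)
  show "B = B - r + r" by simp
  have "scale (1/2) (bracket A (bracket A B)) = r + r"
    by (simp add: r_def scale_two[symmetric])
  then show "reflect A B = B - r - r" by (simp add: reflect_def algebra_simps)
qed

text \<open>
  Write \<open>B = e + r\<close> with \<open>e\<close> even and \<open>r\<close> odd, so that the reflected element is \<open>e - r\<close>. The relation
  that is cubic in \<open>B\<close> says \<open>P + Q = 0\<close> with \<open>P\<close> even and \<open>Q\<close> odd, whence \<open>P = Q = 0\<close>. Changing the sign of
  \<open>r\<close> only changes the sign of \<open>Q\<close>, so the relation persists.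
\<close>

lemma dolan_grady_reflect:
  assumes "dolan_grady A B"
  shows "dolan_grady A (reflect A B)"
proof -
  obtain e r where Ae: "bracket A e = 0" and r: "r \<in> odd_part A"
    and B: "B = e + r" and B': "reflect A B = e - r"
    using even_odd_decomposition assms unfolding dolan_grady_def by blast
  have A: "A \<in> even_part A" and e: "e \<in> even_part A"
    by (simp_all add: commuting_in_even_part bracket_self Ae)
  have eA: "bracket e A = 0" using bracket_skew[of e A] Ae by simp
  define P where "P = bracket e (bracket r (bracket r A)) + bracket r (bracket e (bracket r A))"
  define Q where "Q = bracket e (bracket e (bracket r A)) + bracket r (bracket r (bracket r A))
    - scale 4 (bracket r A)"
  have "P + Q = 0"
    using assms unfolding dolan_grady_def B P_def Q_def
    by (simp add: bracket_linear eA algebra_simps)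
  have rA: "bracket r A \<in> odd_part A" using r A by (rule bracket_odd_even)
  have P: "P \<in> even_part A"
    unfolding P_def
    using bracket_even_even[OF e bracket_odd_odd[OF r rA]] bracket_odd_odd[OF r bracket_even_odd[OF e rA]]
    by (simp add: even_part_def weight_sum_add)
  have "Q \<in> odd_part A"
    unfolding Q_def
    using bracket_even_odd[OF e bracket_even_odd[OF e rA]] bracket_odd_even[OF r bracket_odd_odd[OF r rA]] rA
    by (simp add: odd_part_def weight_sum_add weight_sum_diff weight_sum_scale)
  then have "P = 0"
    using P \<open>P + Q = 0\<close> even_odd_disjoint[of P A]
    by (simp add: eq_neg_iff_add_eq_0[symmetric] odd_part_def weight_sum_minus)
  with \<open>P + Q = 0\<close> have "P - Q = 0" by simp
  then have "bracket (e - r) (bracket (e - r) (bracket (e - r) A)) = scale 4 (bracket (e - r) A)"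
    unfolding P_def Q_def by (simp add: bracket_linear eA algebra_simps)
  moreover have "bracket A (bracket A (bracket A (reflect A B))) = scale 4 (bracket A (reflect A B))"
    using assms unfolding bracket_reflect[OF assms] dolan_grady_def
    by (simp add: bracket_skew[of B A] bracket_minus_right scale_minus_right)
  ultimately show ?thesis by (simp add: dolan_grady_def B')
qed

section \<open>The doubly infinite sequence of a Dolan--Grady pair\<close>

fun dolan_grady_seq :: "'a \<Rightarrow> 'a \<Rightarrow> nat \<Rightarrow> 'a" where
  "dolan_grady_seq A B 0 = A"
| "dolan_grady_seq A B (Suc 0) = B"
| "dolan_grady_seq A B (Suc (Suc n)) =
    reflect (dolan_grady_seq A B (Suc n)) (dolan_grady_seq A B n)"

lemma dolan_grady_seq_consecutive:
  assumes "dolan_grady A B"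
  shows "dolan_grady (dolan_grady_seq A B n) (dolan_grady_seq A B (Suc n))"
proof (induction n)
  case (Suc n)
  then show ?case using dolan_grady_reflect[OF dolan_grady_sym] by simp
qed (simp add: assms)

text \<open>
  The negative half is the forward sequence of the swapped pair; since that one starts with \<open>B\<close> at
  position 1, its \<open>k\<close>-th term sits at position \<open>1 - k\<close>.
\<close>

definition onsager_a :: "'a \<Rightarrow> 'a \<Rightarrow> int \<Rightarrow> 'a" where
  "onsager_a A B n =
    (if n \<ge> 0 then dolan_grady_seq A B (nat n) else dolan_grady_seq B A (nat (1 - n)))"

lemma onsager_a_0: "onsager_a A B 0 = A"
  and onsager_a_1: "onsager_a A B 1 = B"
  by (simp_all add: onsager_a_def)

lemma onsager_a_of_nat: "onsager_a A B (int n) = dolan_grady_seq A B n"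
  by (simp add: onsager_a_def)

lemma onsager_a_one_minus: "onsager_a A B (1 - int n) = dolan_grady_seq B A n"
  by (cases "n = 0"; cases "n = 1") (auto simp: onsager_a_def nat_diff_distrib)

lemma onsager_a_consecutive:
  assumes "dolan_grady A B"
  shows "dolan_grady (onsager_a A B n) (onsager_a A B (n + 1))"
proof (cases n rule: int_cases2)
  case (nonneg k)
  then show ?thesis
    using dolan_grady_seq_consecutive[OF assms, of k] onsager_a_of_nat[of A B "Suc k"]
    by (simp add: onsager_a_of_nat add.commute)
next
  case (nonpos k)
  then show ?thesis
    using dolan_grady_seq_consecutive[OF dolan_grady_sym[OF assms], of k]
      onsager_a_one_minus[of A B k] onsager_a_one_minus[of A B "Suc k"]
    by (simp add: dolan_grady_sym add.commute)
qed

text \<open>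
  On the negative half the definition steps downwards; as \<open>reflect\<close> is an involution on Dolan--Grady
  pairs, it also steps upwards.
\<close>

lemma onsager_a_reflect:
  assumes "dolan_grady A B"
  shows "onsager_a A B (n + 1) = reflect (onsager_a A B n) (onsager_a A B (n - 1))"
proof (cases "n \<ge> 1")
  case True
  define k where "k = nat (n - 1)"
  have n: "n = int (Suc k)" using True by (simp add: k_def)
  have "n + 1 = int (Suc (Suc k))" "n - 1 = int k" by (simp_all add: n)
  then show ?thesis by (simp only: n onsager_a_of_nat dolan_grady_seq.simps)
next
  case False
  define k where "k = nat (- n)"
  have n: "n = 1 - int (Suc k)" "n + 1 = 1 - int k" "n - 1 = 1 - int (Suc (Suc k))"
    using False by (simp_all add: k_def)
  have "onsager_a A B (1 - int (Suc (Suc k))) =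
      reflect (onsager_a A B (1 - int (Suc k))) (onsager_a A B (1 - int k))"
    by (simp only: onsager_a_one_minus dolan_grady_seq.simps)
  then have "onsager_a A B (n - 1) = reflect (onsager_a A B n) (onsager_a A B (n + 1))"
    unfolding n(1)[symmetric] n(2)[symmetric] n(3)[symmetric] .
  then show ?thesis
    using reflect_reflect[OF onsager_a_consecutive[OF assms, of n]] by simp
qed

definition onsager_g :: "'a \<Rightarrow> 'a \<Rightarrow> int \<Rightarrow> 'a" where
  "onsager_g A B l = scale (1/2) (bracket (onsager_a A B l) (onsager_a A B 0))"

end

section \<open>The Onsager relations\<close>

locale dolan_grady_pair = lie_algebra_char_0 scale bracket
  for scale :: "'k::field_char_0 \<Rightarrow> 'a::ab_group_add \<Rightarrow> 'a"
    and bracket :: "'a \<Rightarrow> 'a \<Rightarrow> 'a" +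
  fixes A B :: 'a
  assumes dolan_grady: "dolan_grady A B"
begin

abbreviation a :: "int \<Rightarrow> 'a" where "a \<equiv> onsager_a A B"
abbreviation g :: "int \<Rightarrow> 'a" where "g \<equiv> onsager_g A B"

lemma double_g: "scale 2 (g l) = bracket (a l) (a 0)"
  by (simp add: onsager_g_def)

lemma scale_2_cancel: "scale 2 x = scale 2 y \<Longrightarrow> x = y"
  by simp

text \<open>
  A reflection reverses the sign of the bracket of its pair, so the brackets of neighbours are all
  equal, in both directions along the sequence. It is for this that the whole sequence has to consist
  of Dolan--Grady pairs.
\<close>

lemma bracket_a_consecutive: "bracket (a (n + 1)) (a n) = scale 2 (g 1)"
proof -
  have step: "bracket (a (n + 1)) (a n) = bracket (a n) (a (n - 1))" for n
    using bracket_reflect[OF dolan_grady_sym[OF onsager_a_consecutive[OF dolan_grady, of "n - 1"]]]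
      bracket_skew[of "a (n + 1)" "a n"] bracket_skew[of "a n" "a (n - 1)"]
    by (simp add: onsager_a_reflect[OF dolan_grady, of n])
  show ?thesis
  proof (induction n rule: int_induct[of _ 0])
    case base
    show ?case using double_g[of 1] by simp
  next
    case (step1 n)
    then show ?case using step[of "n + 1"] by simp
  next
    case (step2 n)
    then show ?case using step[of n] by simp
  qed
qed

lemma bracket_g1_a: "bracket (g 1) (a n) = a (n + 1) - a (n - 1)"
proof (rule scale_2_cancel)
  have "scale 2 (bracket (g 1) (a n)) = bracket (bracket (a n) (a (n - 1))) (a n)"
    using bracket_a_consecutive[of "n - 1"] by (simp add: bracket_scale_left[symmetric])
  also have "\<dots> = - bracket (a n) (bracket (a n) (a (n - 1)))"
    by (rule bracket_skew)
  also have "\<dots> = scale 2 (a (n + 1) - a (n - 1))"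
    by (simp add: onsager_a_reflect[OF dolan_grady, of n] reflect_def scale_right_diff_distrib)
  finally show "scale 2 (bracket (g 1) (a n)) = scale 2 (a (n + 1) - a (n - 1))" .
qed

text \<open>
  The induction hypothesis for the relations between terms of the sequence at distance at most \<open>l\<close>.
\<close>

definition onsager_relations_upto :: "nat \<Rightarrow> bool" where
  "onsager_relations_upto l \<longleftrightarrow>
    (\<forall>k\<le>l. \<forall>n. bracket (a (n + int k)) (a n) = scale 2 (g (int k)) \<and>
      bracket (g (int k)) (a n) = a (n + int k) - a (n - int k))"

lemma bracket_a_a_upto:
  assumes "onsager_relations_upto l" and "n \<le> m" and "m \<le> n + int l"
  shows "bracket (a m) (a n) = scale 2 (g (m - n))"
proof -
  obtain k where "m = n + int k" using assms(2) by (metis zle_iff_zadd)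
  then show ?thesis using assms by (simp add: onsager_relations_upto_def)
qed

text \<open>
  Apply \<open>ad g\<^sub>1\<close> to \<open>2 g\<^sub>l = [a\<^bsub>n+l\<^esub>, a\<^sub>n]\<close>: the two inner terms are both \<open>2 g\<^bsub>l-1\<^esub>\<close> and
  cancel. So \<open>[a\<^bsub>n+l+1\<^esub>, a\<^sub>n]\<close> is independent of \<open>n\<close> once \<open>g\<^sub>1\<close> and \<open>g\<^sub>l\<close> commute.
\<close>

lemma bracket_g1_g_difference:
  assumes rel: "onsager_relations_upto l" and l: "l \<ge> 1"
  shows "scale 2 (bracket (g 1) (g (int l))) =
    bracket (a (n + int l + 1)) (a n) - bracket (a (n + int l)) (a (n - 1))"
proof -
  have "scale 2 (bracket (g 1) (g (int l))) = bracket (g 1) (bracket (a (n + int l)) (a n))"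
    by (simp add: bracket_a_a_upto[OF rel] bracket_linear)
  also have "\<dots> = bracket (a (n + int l + 1) - a (n + int l - 1)) (a n)
      + bracket (a (n + int l)) (a (n + 1) - a (n - 1))"
    by (simp add: bracket_derivation[of "g 1"] bracket_g1_a)
  also have "\<dots> = bracket (a (n + int l + 1)) (a n) - bracket (a (n + int l)) (a (n - 1))"
    using l by (simp add: bracket_linear bracket_a_a_upto[OF rel] algebra_simps)
  finally show ?thesis .
qed

text \<open>
  The bracket \<open>[g\<^sub>1, g\<^sub>l]\<close> is computed twice. With \<open>ad g\<^sub>1\<close> as derivation, the differences in the
  preceding lemma telescope, so that \<open>l\<close> of them add up to \<open>2 l [g\<^sub>1, g\<^sub>l]\<close>. With \<open>ad g\<^sub>l\<close> as derivation,
  applied to \<open>2 g\<^sub>1 = [a\<^sub>1, a\<^sub>0]\<close>, the same sum is \<open>2 [g\<^sub>l, g\<^sub>1]\<close>. Hence \<open>(l + 1) [g\<^sub>1, g\<^sub>l] = 0\<close>.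
\<close>

lemma g1_commutes_step:
  assumes rel: "onsager_relations_upto l" and l: "l \<ge> 1"
  shows "bracket (g 1) (g (int l)) = 0"
proof -
  let ?H = "\<lambda>n. bracket (a (n + int l + 1)) (a n)"
  have telescope: "?H n - ?H (n - int k) = scale (of_nat k) (scale 2 (bracket (g 1) (g (int l))))"
    for n k
  proof (induction k)
    case (Suc k)
    have step: "?H (n - int k) - ?H (n - int k - 1) = scale 2 (bracket (g 1) (g (int l)))"
      using bracket_g1_g_difference[OF rel l, of "n - int k"] by (simp add: algebra_simps)
    have "?H n - ?H (n - int (Suc k)) =
        (?H n - ?H (n - int k)) + (?H (n - int k) - ?H (n - int k - 1))"
      by (simp add: algebra_simps)
    also have "\<dots> = scale (of_nat (Suc k)) (scale 2 (bracket (g 1) (g (int l))))"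
      unfolding Suc.IH step of_nat_Suc scale_left_distrib scale_one
      by (rule add.commute)
    finally show ?case .
  qed simp
  have "scale 2 (bracket (g (int l)) (g 1)) = bracket (g (int l)) (bracket (a 1) (a 0))"
    by (simp only: bracket_scale_right[symmetric] double_g)
  also have "\<dots> = bracket (a (1 + int l) - a (1 - int l)) (a 0) + bracket (a 1) (a (int l) - a (- int l))"
    using rel by (simp add: bracket_derivation[of "g (int l)"] onsager_relations_upto_def)
  also have "\<dots> = ?H 0 - ?H (0 - int l)"
    using l bracket_a_a_upto[OF rel, of "1 - int l" 0] bracket_a_a_upto[OF rel, of 1 "int l"]
      bracket_skew[of "a (1 - int l)" "a 0"] bracket_skew[of "a 1" "a (int l)"]
    by (simp add: bracket_linear algebra_simps)
  also have "\<dots> = scale (of_nat l) (scale 2 (bracket (g 1) (g (int l))))"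
    by (rule telescope)
  finally have "- scale 2 (bracket (g 1) (g (int l))) =
      scale (of_nat l) (scale 2 (bracket (g 1) (g (int l))))"
    by (simp only: bracket_skew[of "g (int l)" "g 1"] scale_minus_right)
  then have "scale (of_nat (Suc l)) (scale 2 (bracket (g 1) (g (int l)))) = 0"
    by (simp only: of_nat_Suc scale_left_distrib scale_one) (metis add.right_inverse)
  then have "scale 2 (bracket (g 1) (g (int l))) = 0" by (rule scale_cancel_of_nat)
  then show ?thesis by simp
qed

text \<open>
  The relation for \<open>[g\<^bsub>l+1\<^esub>, a\<^sub>n]\<close> is the Jacobi identity of \<open>a\<^bsub>n+l\<^esub>, a\<^sub>n, a\<^bsub>n-1\<^esub>\<close>: the outer two have
  bracket \<open>2 g\<^bsub>l+1\<^esub>\<close>, and the other two brackets involve only \<open>g\<^sub>l\<close> and \<open>g\<^sub>1\<close>.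
\<close>

lemma onsager_relations_step:
  assumes rel: "onsager_relations_upto l" and l: "l \<ge> 1"
  shows "onsager_relations_upto (Suc l)"
proof -
  let ?H = "\<lambda>n. bracket (a (n + int (Suc l))) (a n)"
  have shift: "?H n = ?H (n - 1)" for n
    using bracket_g1_g_difference[OF rel l, of n] g1_commutes_step[OF rel l]
    by (simp add: algebra_simps)
  have H: "?H n = scale 2 (g (int (Suc l)))" for n
  proof (induction n rule: int_induct[of _ 0])
    case base
    show ?case using double_g by simp
  next
    case (step1 n)
    then show ?case using shift[of "n + 1"] by simp
  next
    case (step2 n)
    then show ?case using shift[of n] by simp
  qed
  have "bracket (g (int (Suc l))) (a n) = a (n + int (Suc l)) - a (n - int (Suc l))" for n
  proof (rule scale_2_cancel)
    have g: "bracket (g (int k)) (a m) = a (m + int k) - a (m - int k)" if "k \<le> l" for k m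
      using rel that by (simp add: onsager_relations_upto_def)
    have "scale 2 (bracket (g (int (Suc l))) (a n)) =
        - bracket (a n) (bracket (a (n + int l)) (a (n - 1)))"
      using H[of "n - 1"] bracket_skew[of _ "a n"] by (simp add: bracket_linear algebra_simps)
    also have "\<dots> = bracket (bracket (a (n + int l)) (a n)) (a (n - 1))
        + bracket (bracket (a n) (a (n - 1))) (a (n + int l))"
      using bracket_skew[of "a n" "a (n + int l)"]
        bracket_skew[of "a (n + int l)" "bracket (a n) (a (n - 1))"]
      by (simp add: bracket_derivation[of "a n"] bracket_linear)
    also have "\<dots> = scale 2 (bracket (g (int l)) (a (n - 1)) + bracket (g (int 1)) (a (n + int l)))"
      using l by (simp add: bracket_a_a_upto[OF rel] bracket_linear scale_right_distrib)
    also have "\<dots> = scale 2 (a (n + int (Suc l)) - a (n - int (Suc l)))"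
      using l by (simp only: g) (simp add: algebra_simps)
    finally show "scale 2 (bracket (g (int (Suc l))) (a n)) =
      scale 2 (a (n + int (Suc l)) - a (n - int (Suc l)))" .
  qed
  with H rel show ?thesis
    unfolding onsager_relations_upto_def by (metis le_Suc_eq)
qed

lemma onsager_relations_all: "onsager_relations_upto l"
proof (induction l)
  case 0
  show ?case by (simp add: onsager_relations_upto_def onsager_g_def bracket_self)
next
  case (Suc l)
  show ?case
  proof (cases "l = 0")
    case True
    then show ?thesis
      using Suc bracket_a_consecutive bracket_g1_a
      by (auto simp: onsager_relations_upto_def le_Suc_eq)
  next
    case False
    then show ?thesis using Suc by (intro onsager_relations_step) auto
  qed
qed

lemma bracket_a_a: "bracket (a m) (a n) = scale 2 (g (m - n))"
proof -
  have nonneg: "bracket (a (n + int k)) (a n) = scale 2 (g (int k))" for n k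
    using onsager_relations_all[of k] by (simp add: onsager_relations_upto_def)
  show ?thesis
  proof (cases "n \<le> m")
    case True
    then obtain k where "m = n + int k" by (metis zle_iff_zadd)
    then show ?thesis by (simp add: nonneg)
  next
    case False
    then obtain k where k: "n = m + int k" by (metis linear zle_iff_zadd)
    have "bracket (a m) (a n) = - scale 2 (g (int k))"
      using nonneg[of m k] bracket_skew[of "a m" "a n"] by (simp add: k)
    also have "\<dots> = - bracket (a (- int k + int k)) (a (- int k))"
      by (simp only: nonneg)
    also have "\<dots> = scale 2 (g (m - n))"
      using bracket_skew[of "a 0" "a (- int k)"] by (simp add: double_g k)
    finally show ?thesis .
  qed
qed

lemma g_minus: "g (- l) = - g l"
  by (rule scale_2_cancel)
    (use bracket_a_a[of l 0] bracket_a_a[of 0 l] bracket_skew[of "a 0" "a l"] in simp)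

lemma bracket_g_a: "bracket (g l) (a n) = a (n + l) - a (n - l)"
proof -
  have nonneg: "bracket (g (int k)) (a n) = a (n + int k) - a (n - int k)" for n k
    using onsager_relations_all[of k] by (simp add: onsager_relations_upto_def)
  show ?thesis
    by (cases l rule: int_cases2) (simp_all add: nonneg g_minus bracket_minus_left)
qed

lemma bracket_a_g: "bracket (a n) (g l) = a (n - l) - a (n + l)"
  using bracket_g_a[of l n] bracket_skew[of "a n" "g l"] by simp

lemma bracket_g_g: "bracket (g l) (g m) = 0"
proof -
  have "scale 2 (bracket (g l) (g m)) = bracket (g l) (bracket (a m) (a 0))"
    by (simp only: double_g[symmetric] bracket_scale_right)
  also have "\<dots> = 0"
    by (simp only: bracket_derivation[of "g l"] bracket_g_a)
      (simp add: bracket_linear bracket_a_a)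
  finally show ?thesis by simp
qed

section \<open>The homomorphism from the Onsager algebra\<close>

definition onsager_basis_image :: "onsager_index \<Rightarrow> 'a" where
  "onsager_basis_image b = (case b of A_index n \<Rightarrow> a n | G_index l \<Rightarrow> g (int (Rep_pos_nat l)))"

definition onsager_map :: "'k onsager \<Rightarrow> 'a" where
  "onsager_map x =
    (\<Sum>b\<in>Poly_Mapping.keys x. scale (Poly_Mapping.lookup x b) (onsager_basis_image b))"

lemma onsager_map_superset:
  assumes "finite S" "Poly_Mapping.keys x \<subseteq> S"
  shows "onsager_map x = (\<Sum>b\<in>S. scale (Poly_Mapping.lookup x b) (onsager_basis_image b))"
  unfolding onsager_map_def using assms
  by (intro sum.mono_neutral_left) (auto simp: in_keys_iff)

lemma onsager_map_add: "onsager_map (x + y) = onsager_map x + onsager_map y"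
proof -
  let ?S = "Poly_Mapping.keys x \<union> Poly_Mapping.keys y"
  have "Poly_Mapping.keys (x + y) \<subseteq> ?S" by (rule Poly_Mapping.keys_add)
  then show ?thesis
    by (simp add: onsager_map_superset[of ?S] lookup_add scale_left_distrib sum.distrib)
qed

lemma onsager_map_scale: "onsager_map (ons_scale c x) = scale c (onsager_map x)"
  by (simp add: onsager_map_superset[of "Poly_Mapping.keys x"] keys_ons_scale scale_sum_right)

lemma onsager_map_zero [simp]: "onsager_map 0 = 0"
  by (simp add: onsager_map_def)

lemma onsager_map_minus: "onsager_map (- x) = - onsager_map x"
  using onsager_map_scale[of "- 1" x] by simp

lemma onsager_map_diff: "onsager_map (x - y) = onsager_map x - onsager_map y"
  using onsager_map_add[of x "- y"] by (simp add: onsager_map_minus)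

lemma onsager_map_single:
  "onsager_map (Poly_Mapping.single b c) = scale c (onsager_basis_image b)"
  by (subst onsager_map_superset[of "{b}"]) auto

lemma onsager_map_A: "onsager_map (ons_A n) = a n"
  by (simp add: ons_A_def onsager_map_single onsager_basis_image_def)

lemma onsager_map_G: "onsager_map (ons_G_int l) = g l"
proof -
  have pos: "onsager_map (ons_G l) = g (int l)" if "l > 0" for l
    using that by (simp add: ons_G_def onsager_map_single onsager_basis_image_def Abs_pos_nat_inverse)
  have "g 0 = 0" by (simp add: onsager_g_def bracket_self)
  then show ?thesis
    using g_minus[of l] by (auto simp: ons_G_int_def onsager_map_minus pos)
qed

lemma onsager_map_bracket: "onsager_map (ons_bracket x y) = bracket (onsager_map x) (onsager_map y)"
proof -
  have single: "onsager_map (ons_bracket (Poly_Mapping.single b c) (Poly_Mapping.single d e)) =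
      bracket (onsager_map (Poly_Mapping.single b c)) (onsager_map (Poly_Mapping.single d e))"
    for b c d e
    by (cases rule: ons_basis_cases[of b c]; cases rule: ons_basis_cases[of d e])
      (simp_all add: ons_bracket_scale_left ons_bracket_scale_right ons_bracket_A_A
        ons_bracket_G_A ons_bracket_G_G onsager_map_scale onsager_map_diff onsager_map_A
        onsager_map_G bracket_linear bracket_a_a bracket_g_a bracket_a_g bracket_g_g)
  have left: "onsager_map (ons_bracket x (Poly_Mapping.single d e)) =
      bracket (onsager_map x) (onsager_map (Poly_Mapping.single d e))" for x d e
    by (induction x rule: onsager_induct)
      (simp_all add: ons_bracket_add_left onsager_map_add bracket_linear single)
  show ?thesis
    by (induction y rule: onsager_induct)
      (simp_all add: ons_bracket_add_right onsager_map_add bracket_linear left)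
qed

lemma lie_generated_incl: "x \<in> S \<Longrightarrow> x \<in> lie_generated S"
  by (simp add: lie_generated_def hull_inc)

text \<open>
  The range is a subalgebra because the map is a homomorphism. Conversely each \<open>a\<^sub>n\<close> and \<open>g\<^sub>l\<close> is
  obtained from \<open>A\<close> and \<open>B\<close> by brackets and linear combinations.
\<close>

lemma range_onsager_map: "range onsager_map = lie_generated {A, B}"
proof
  have "subspace (range onsager_map)"
    unfolding subspace_def
    by (auto simp flip: onsager_map_add onsager_map_scale intro: range_eqI[of _ _ 0])
  then have "lie_subalgebra (range onsager_map)"
    by (auto simp: lie_subalgebra_def simp flip: onsager_map_bracket)
  moreover have "{A, B} \<subseteq> range onsager_map"
    using onsager_map_A[of 0] onsager_map_A[of 1] unfolding onsager_a_0 onsager_a_1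
    by (auto intro: range_eqI[OF HOL.sym])
  ultimately show "lie_generated {A, B} \<subseteq> range onsager_map"
    unfolding lie_generated_def by (intro hull_minimal)
next
  let ?S = "lie_generated {A, B}"
  have S: "subspace ?S" "\<And>x y. x \<in> ?S \<Longrightarrow> y \<in> ?S \<Longrightarrow> bracket x y \<in> ?S"
    using lie_subalgebra_generated[of "{A, B}"] by (auto simp: lie_subalgebra_def)
  have reflect: "reflect x y \<in> ?S" if "x \<in> ?S" "y \<in> ?S" for x y
    unfolding reflect_def using S that by (intro subspace_diff subspace_scale) auto
  have seq: "dolan_grady_seq x y n \<in> ?S" if "x \<in> ?S" "y \<in> ?S" for x y n
    using that by (induction x y n rule: dolan_grady_seq.induct) (auto intro: reflect)
  have AB: "A \<in> ?S" "B \<in> ?S" by (auto intro: lie_generated_incl)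
  have "a n \<in> ?S" for n
    using seq AB by (simp add: onsager_a_def)
  moreover from this have "g l \<in> ?S" for l
    unfolding onsager_g_def using S by (intro subspace_scale) auto
  ultimately have "onsager_basis_image b \<in> ?S" for b
    by (cases b) (simp_all add: onsager_basis_image_def)
  then show "range onsager_map \<subseteq> ?S"
    unfolding onsager_map_def using S by (auto intro!: subspace_sum subspace_scale)
qed

end

section \<open>Quadratic vector fields on the projective line\<close>

text \<open>
  The triple \<open>(u, v, w)\<close> stands for the vector field \<open>(u + v z + w z\<^sup>2) d/dz\<close>. The bracket is
  \<open>f g' - f' g\<close>, so over a field of characteristic other than 2 this is a model of the Lie algebra of
  2 by 2 matrices of trace zero.
\<close>

type_synonym 'r quadratic = "'r \<times> 'r \<times> 'r"

definition quad_scale :: "'r::comm_ring_1 \<Rightarrow> 'r quadratic \<Rightarrow> 'r quadratic" where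
  "quad_scale c f = (case f of (u, v, w) \<Rightarrow> (c * u, c * v, c * w))"

definition quad_bracket :: "'r::comm_ring_1 quadratic \<Rightarrow> 'r quadratic \<Rightarrow> 'r quadratic" where
  "quad_bracket f g = (case f of (u, v, w) \<Rightarrow> case g of (u', v', w') \<Rightarrow>
    (u * v' - u' * v, 2 * (u * w' - u' * w), v * w' - v' * w))"

text \<open>
  The vector field \<open>- 2 (z - p) (z - q) / (p - q) d/dz\<close>, which vanishes at \<open>p\<close> and \<open>q\<close>. The factor makes
  \<open>0, 2, -2\<close> the eigenvalues of its adjoint action. For four distinct points, these fields
  satisfy the relations of the tetrahedron algebra.
\<close>

definition two_point_field :: "'r::field \<Rightarrow> 'r \<Rightarrow> 'r quadratic" where
  "two_point_field p q = quad_scale (- 2 / (p - q)) (p * q, - p - q, 1)"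

lemma two_point_field_swap:
  assumes "p \<noteq> q"
  shows "two_point_field p q + two_point_field q p = 0"
  using assms by (simp add: two_point_field_def quad_scale_def zero_prod_def field_simps)

lemma two_point_field_bracket:
  assumes "p \<noteq> q" "q \<noteq> r" "p \<noteq> r"
  shows "quad_bracket (two_point_field p q) (two_point_field q r) =
    quad_scale 2 (two_point_field p q + two_point_field q r)"
  using assms
  by (simp add: two_point_field_def quad_scale_def quad_bracket_def divide_simps)
    (simp add: algebra_simps)

text \<open>
  The eigenvalues of \<open>ad f\<close> are \<open>0\<close> and the two square roots of the discriminant of \<open>f\<close>.
\<close>

lemma quad_bracket_cubic:
  fixes u v w :: "'r::comm_ring_1"
  shows "quad_bracket (u, v, w) (quad_bracket (u, v, w) (quad_bracket (u, v, w) g)) =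
    quad_scale (v * v - 4 * u * w) (quad_bracket (u, v, w) g)"
  by (cases g) (simp add: quad_scale_def quad_bracket_def algebra_simps)

lemma two_point_field_cubic:
  assumes "p \<noteq> q"
  shows "quad_bracket (two_point_field p q) (quad_bracket (two_point_field p q)
      (quad_bracket (two_point_field p q) g)) =
    quad_scale 4 (quad_bracket (two_point_field p q) g)"
proof -
  define s where "s = - 2 / (p - q)"
  have "(s * (- p - q)) * (s * (- p - q)) - 4 * (s * (p * q)) * (s * 1) = s ^ 2 * (p - q) ^ 2"
    by (simp add: algebra_simps power2_eq_square)
  also have "\<dots> = 4" using assms by (simp add: s_def power_divide)
  finally have disc: "(s * (- p - q)) * (s * (- p - q)) - 4 * (s * (p * q)) * (s * 1) = 4" .
  have "two_point_field p q = (s * (p * q), s * (- p - q), s * 1)"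
    unfolding two_point_field_def quad_scale_def s_def by simp
  then show ?thesis by (simp only: quad_bracket_cubic disc)
qed

text \<open>
  The vector fields with Laurent series as coefficients, viewed over the constants.
\<close>

definition loop_scale :: "'k::field_char_0 \<Rightarrow> 'k fls quadratic \<Rightarrow> 'k fls quadratic" where
  "loop_scale c = quad_scale (fls_const c)"

lemma loop_lie_algebra: "lie_algebra (loop_scale :: 'k::field_char_0 \<Rightarrow> _) quad_bracket"
proof
  fix c d :: 'k and x y z :: "'k fls quadratic"
  note defs = loop_scale_def quad_scale_def quad_bracket_def zero_prod_def
  show "loop_scale c (x + y) = loop_scale c x + loop_scale c y"
    by (cases x; cases y) (simp add: defs algebra_simps)
  show "loop_scale (c + d) x = loop_scale c x + loop_scale d x"
    by (cases x) (simp add: defs algebra_simps flip: fls_plus_const)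
  show "loop_scale c (loop_scale d x) = loop_scale (c * d) x"
    by (cases x) (simp add: defs mult.assoc flip: fls_const_mult_const)
  show "loop_scale 1 x = x"
    by (cases x) (simp add: defs)
  show "quad_bracket (x + y) z = quad_bracket x z + quad_bracket y z"
    by (cases x; cases y; cases z) (simp add: defs algebra_simps)
  show "quad_bracket x (y + z) = quad_bracket x y + quad_bracket x z"
    by (cases x; cases y; cases z) (simp add: defs algebra_simps)
  show "quad_bracket (loop_scale c x) y = loop_scale c (quad_bracket x y)"
    by (cases x; cases y) (simp add: defs algebra_simps)
  show "quad_bracket x (loop_scale c y) = loop_scale c (quad_bracket x y)"
    by (cases x; cases y) (simp add: defs algebra_simps)
  show "quad_bracket x x = 0"
    by (cases x) (simp add: defs)
  show "quad_bracket x (quad_bracket y z) + quad_bracket y (quad_bracket z x)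
      + quad_bracket z (quad_bracket x y) = 0"
    by (cases x; cases y; cases z) (simp add: defs algebra_simps)
qed

section \<open>Representing the tetrahedron algebra\<close>

lemma tetrahedron_universal:
  fixes scale :: "'k::field_char_0 \<Rightarrow> 'b::ab_group_add \<Rightarrow> 'b"
  assumes "lie_algebra scale bracket"
    and skew: "\<And>i j. i \<noteq> j \<Longrightarrow> Y i j + Y j i = 0"
    and adjacent: "\<And>i j m. distinct [i, j, m] \<Longrightarrow> bracket (Y i j) (Y j m) = scale 2 (Y i j + Y j m)"
    and cubic: "\<And>h i j m. distinct [h, i, j, m] \<Longrightarrow>
      bracket (Y h i) (bracket (Y h i) (bracket (Y h i) (Y j m))) = scale 4 (bracket (Y h i) (Y j m))"
  obtains \<rho> :: "'k tetrahedron \<Rightarrow> 'b"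
    where "\<And>x y. \<rho> (x + y) = \<rho> x + \<rho> y" "\<And>c x. \<rho> (tet_scale c x) = scale c (\<rho> x)"
      "\<And>x y. \<rho> (tet_bracket x y) = bracket (\<rho> x) (\<rho> y)" "\<And>i j. i \<noteq> j \<Longrightarrow> \<rho> (X i j) = Y i j"
proof -
  interpret lie_algebra scale bracket by fact
  define \<phi> where "\<phi> s = (case Rep_tet_gen s of (i, j) \<Rightarrow> Y i j)" for s
  have gen: "eval_term \<phi> (tet_X i j) = Y i j" if "i \<noteq> j" for i j
    using that by (simp add: tet_X_def \<phi>_def Abs_tet_gen_inverse)
  have rels: "eval_term \<phi> u = eval_term \<phi> v" if "(u, v) \<in> tet_rels" for u v
    using that by (auto simp: tet_rels_def gen skew adjacent cubic)
  define \<rho> where "\<rho> x = eval_term \<phi> (rep_tetrahedron x)" for x :: "'k tetrahedron"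
  have abs: "\<rho> (abs_tetrahedron s) = eval_term \<phi> s" for s
    unfolding \<rho>_def
    by (rule eval_term_cong[OF _ rels])
      (rule Quotient_rep_abs[OF Quotient_tetrahedron lie_cong.refl])
  show ?thesis
  proof
    fix x y :: "'k tetrahedron" and c i j
    obtain s t where st: "x = abs_tetrahedron s" "y = abs_tetrahedron t"
      using Quotient_abs_rep[OF Quotient_tetrahedron, symmetric] by blast
    show "\<rho> (x + y) = \<rho> x + \<rho> y" by (simp add: st plus_tetrahedron.abs_eq abs)
    show "\<rho> (tet_scale c x) = scale c (\<rho> x)" by (simp add: st tet_scale.abs_eq abs)
    show "\<rho> (tet_bracket x y) = bracket (\<rho> x) (\<rho> y)" by (simp add: st tet_bracket.abs_eq abs)
    show "i \<noteq> j \<Longrightarrow> \<rho> (X i j) = Y i j" by (simp add: X.abs_eq abs gen)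
  qed
qed

lemma four_distinct_UNIV:
  fixes h i j m :: 4
  assumes "distinct [h, i, j, m]"
  shows "UNIV = {h, i, j, m}"
  by (rule card_subset_eq[symmetric]) (use assms in simp_all)

definition laurent_monomial :: "int \<Rightarrow> 'k::field_char_0 fls" where
  "laurent_monomial n = fls_X_intpow n"

lemma laurent_monomial_mult:
  "laurent_monomial m * laurent_monomial n = laurent_monomial (m + n)"
  by (simp only: laurent_monomial_def fls_X_intpow_times_fls_X_intpow)

lemma laurent_monomial_nth: "fls_nth (laurent_monomial n) k = (if k = n then 1 else 0)"
  by (simp add: laurent_monomial_def)

lemma laurent_monomial_0: "laurent_monomial 0 = 1"
  by (simp add: laurent_monomial_def)

lemma laurent_monomial_1: "laurent_monomial 1 = fls_X"
  by (rule fls_eqI) (simp add: laurent_monomial_nth)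

lemma laurent_monomial_minus_1: "laurent_monomial (- 1) = (1 / fls_X :: 'k::field_char_0 fls)"
proof -
  have "laurent_monomial (- 1) * fls_X = (1 :: 'k fls)"
    by (simp add: laurent_monomial_mult laurent_monomial_0 flip: laurent_monomial_1)
  then show ?thesis by (simp add: eq_divide_eq del: fls_divide_X)
qed

text \<open>
  With \<open>E = d/dz\<close>, \<open>F = - z\<^sup>2 d/dz\<close> and \<open>H = [E, F] = - 2 z d/dz\<close> these are \<open>E t\<^sup>n + F t\<^bsup>-n\<^esup>\<close> and
  \<open>H (t\<^sup>l - t\<^bsup>-l\<^esup>) / 2\<close>, the image of the basis under the embedding of the Onsager algebra
  into the loop algebra of trace-zero matrices.
\<close>

definition loop_a :: "int \<Rightarrow> 'k::field_char_0 fls quadratic" where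
  "loop_a n = (laurent_monomial n, 0, - laurent_monomial (- n))"

definition loop_g :: "int \<Rightarrow> 'k::field_char_0 fls quadratic" where
  "loop_g l = (0, laurent_monomial (- l) - laurent_monomial l, 0)"

lemma loop_bracket_a_a: "quad_bracket (loop_a l) (loop_a n) = loop_scale 2 (loop_g (l - n))"
  by (simp add: loop_a_def loop_g_def loop_scale_def quad_scale_def quad_bracket_def
      laurent_monomial_mult)

lemma loop_bracket_g_a: "quad_bracket (loop_g l) (loop_a n) = loop_a (n + l) - loop_a (n - l)"
  by (simp add: loop_a_def loop_g_def quad_bracket_def algebra_simps
      laurent_monomial_mult)

text \<open>
  The four points \<open>1, -1, t, -t\<close> are chosen so that the generators for the two opposite edges go to
  \<open>(1 - z\<^sup>2) d/dz\<close> and \<open>(t - z\<^sup>2 / t) d/dz\<close>.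
\<close>

lemma tetrahedron_to_loop:
  fixes h i j m :: 4
  assumes dist: "distinct [h, i, j, m]"
  obtains \<rho> :: "'k::field_char_0 tetrahedron \<Rightarrow> 'k fls quadratic"
    where "\<And>x y. \<rho> (x + y) = \<rho> x + \<rho> y" "\<And>c x. \<rho> (tet_scale c x) = loop_scale c (\<rho> x)"
      "\<And>x y. \<rho> (tet_bracket x y) = quad_bracket (\<rho> x) (\<rho> y)"
      "\<rho> (X h i) = loop_a 0" "\<rho> (X j m) = loop_a 1"
proof -
  define p :: "4 \<Rightarrow> 'k fls" where
    "p b = (if b = h then 1 else if b = i then - 1 else if b = j then fls_X else - fls_X)" for b
  have ne: "fls_X \<noteq> (1 :: 'k fls)" "fls_X \<noteq> (- 1 :: 'k fls)"
    by (auto simp: fls_eq_iff intro!: exI[of _ 1])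
  then have ne': "- fls_X \<noteq> (1 :: 'k fls)" "1 \<noteq> (fls_X :: 'k fls)" "- 1 \<noteq> (fls_X :: 'k fls)"
      "1 \<noteq> - (fls_X :: 'k fls)"
    by (metis minus_minus)+
  have "(1 :: 'k fls) \<noteq> - 1" "(fls_X :: 'k fls) \<noteq> - fls_X"
    by (simp_all add: eq_neg_iff_add_eq_0 flip: mult_2)
  then have p: "b \<noteq> c \<Longrightarrow> p b \<noteq> p c" for b c
    using UNIV_I[of b] UNIV_I[of c] dist ne ne' unfolding four_distinct_UNIV[OF dist]
    by (auto simp: p_def)
  have scale: "loop_scale (2 :: 'k) = quad_scale 2" "loop_scale (4 :: 'k) = quad_scale 4"
    by (simp_all add: loop_scale_def)
  obtain \<rho> :: "'k tetrahedron \<Rightarrow> 'k fls quadratic"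
    where \<rho>: "\<And>x y. \<rho> (x + y) = \<rho> x + \<rho> y" "\<And>c x. \<rho> (tet_scale c x) = loop_scale c (\<rho> x)"
      "\<And>x y. \<rho> (tet_bracket x y) = quad_bracket (\<rho> x) (\<rho> y)"
      "\<And>b c. b \<noteq> c \<Longrightarrow> \<rho> (X b c) = two_point_field (p b) (p c)"
    by (rule tetrahedron_universal[OF loop_lie_algebra, of "\<lambda>b c. two_point_field (p b) (p c)"])
      (auto simp: two_point_field_swap two_point_field_bracket two_point_field_cubic p scale)
  have "two_point_field (1 :: 'k fls) (- 1) = loop_a 0"
    by (simp add: two_point_field_def loop_a_def quad_scale_def laurent_monomial_0
        laurent_monomial_1[unfolded One_nat_def] laurent_monomial_minus_1 del: fls_divide_X)
  moreover have "two_point_field (fls_X :: 'k fls) (- fls_X) = loop_a 1"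
    by (simp add: two_point_field_def loop_a_def quad_scale_def laurent_monomial_0
        laurent_monomial_1[unfolded One_nat_def] laurent_monomial_minus_1 del: fls_divide_X)
  moreover have "p h = 1" "p i = - 1" "p j = fls_X" "p m = - fls_X"
    using dist by (auto simp: p_def)
  ultimately have "\<rho> (X h i) = loop_a 0" "\<rho> (X j m) = loop_a 1"
    using dist by (simp_all add: \<rho>(4))
  with \<rho>(1-3) show ?thesis by (rule that)
qed

section \<open>Opposite edges generate the Onsager algebra\<close>

interpretation tet: lie_algebra_char_0 tet_scale tet_bracket ..

theorem proposition4p2p4:
  fixes h i j m :: 4
  assumes "distinct [h, i, j, m]"
  shows "lie_isomorphic
    (tet_scale :: 'k::field_char_0 \<Rightarrow> 'k tetrahedron \<Rightarrow> 'k tetrahedron) tet_bracket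
    (tetrahedron.lie_generated {X h i, X j m})
    (ons_scale :: 'k \<Rightarrow> 'k onsager \<Rightarrow> 'k onsager) ons_bracket UNIV"
proof -
  have "distinct [j, m, h, i]" using assms by auto
  then interpret dolan_grady_pair tet_scale tet_bracket "X h i :: 'k tetrahedron" "X j m"
    using tetrahedron_relations(3)[OF assms] tetrahedron_relations(3)[of j m h i]
    by unfold_locales (simp add: tet.dolan_grady_def)
  interpret loop: lie_algebra "loop_scale :: 'k \<Rightarrow> _" quad_bracket
    by (rule loop_lie_algebra)
  obtain \<rho> :: "'k tetrahedron \<Rightarrow> 'k fls quadratic"
    where \<rho>: "\<And>x y. \<rho> (x + y) = \<rho> x + \<rho> y" "\<And>c x. \<rho> (tet_scale c x) = loop_scale c (\<rho> x)"
      "\<And>x y. \<rho> (tet_bracket x y) = quad_bracket (\<rho> x) (\<rho> y)"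
      "\<rho> (X h i) = loop_a 0" "\<rho> (X j m) = loop_a 1"
    by (rule tetrahedron_to_loop[OF assms]) (rule that)
  have half: "\<rho> (tet_scale (1/2) x) = y" if "\<rho> x = loop_scale 2 y" for x y
    by (simp add: \<rho> that)
  \<comment> \<open>The composite of \<open>onsager_map\<close> and \<open>\<rho>\<close> is determined by its values at \<open>A\<^sub>0\<close> and \<open>A\<^sub>1\<close>.\<close>
  have \<rho>_g1: "\<rho> (g 1) = loop_g 1"
    unfolding tet.onsager_g_def
    by (rule half) (simp add: \<rho> tet.onsager_a_0 tet.onsager_a_1 loop_bracket_a_a)
  have \<rho>_step: "\<rho> (a (n + 1)) = \<rho> (a (n - 1)) + quad_bracket (loop_g 1) (\<rho> (a n))" for n
  proof -
    have "\<rho> (a (n + 1)) = \<rho> (a (n - 1) + tet_bracket (g 1) (a n))"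
      by (simp add: bracket_g1_a)
    then show ?thesis by (simp only: \<rho>(1,3) \<rho>_g1)
  qed
  \<comment> \<open>Two consecutive terms at a time, because the recursion has order two.\<close>
  have \<rho>_a2: "\<rho> (a n) = loop_a n \<and> \<rho> (a (n + 1)) = loop_a (n + 1)" for n
  proof (induction n rule: int_induct[of _ 0])
    case base
    show ?case by (simp add: \<rho> tet.onsager_a_0 tet.onsager_a_1)
  next
    case (step1 n)
    then show ?case using \<rho>_step[of "n + 1"] by (simp add: loop_bracket_g_a)
  next
    case (step2 n)
    have "\<rho> (a (n - 1)) + quad_bracket (loop_g 1) (loop_a n) = loop_a (n + 1)"
      using \<rho>_step[of n] step2.IH by metis
    then have "\<rho> (a (n - 1)) = loop_a (n - 1)"
      by (simp add: loop_bracket_g_a algebra_simps)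
    then show ?case using step2.IH by simp
  qed
  then have \<rho>_a: "\<rho> (a n) = loop_a n" for n by blast
  have \<rho>_g: "\<rho> (g l) = loop_g l" for l
    unfolding tet.onsager_g_def by (rule half) (simp add: \<rho> \<rho>_a loop_bracket_a_a)
  have \<rho>_0: "\<rho> 0 = 0" using \<rho>(1)[of 0 0] by simp
  \<comment> \<open>The coordinates of \<open>x\<close> are up to sign, Laurent coefficients of its image.\<close>
  have coeff_A: "fls_nth (fst (\<rho> (onsager_map x))) n = Poly_Mapping.lookup x (A_index n)" for x n
  proof (induction x rule: onsager_induct)
    case (add b c x)
    then show ?case
      by (cases b) (auto simp: onsager_map_add onsager_map_single onsager_basis_image_def \<rho> \<rho>_a \<rho>_g
          lookup_add lookup_single when_def loop_scale_def quad_scale_def loop_a_def loop_g_def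
          laurent_monomial_nth)
  qed (simp add: \<rho>_0)
  have coeff_G: "fls_nth (fst (snd (\<rho> (onsager_map x)))) (int (Rep_pos_nat l)) =
      - Poly_Mapping.lookup x (G_index l)" for x l
  proof (induction x rule: onsager_induct)
    case (add b c x)
    then show ?case
      using Rep_pos_nat[of l]
      by (cases b) (auto simp: onsager_map_add onsager_map_single onsager_basis_image_def \<rho> \<rho>_a \<rho>_g
          lookup_add lookup_single when_def loop_scale_def quad_scale_def loop_a_def loop_g_def
          laurent_monomial_nth Rep_pos_nat_inject algebra_simps)
  qed (simp add: \<rho>_0)
  have "inj onsager_map"
  proof (rule injI, rule poly_mapping_eqI)
    fix x y b
    assume "onsager_map x = onsager_map y"
    then show "Poly_Mapping.lookup x b = Poly_Mapping.lookup y b"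
      using coeff_A[of x] coeff_A[of y] coeff_G[of x] coeff_G[of y]
      by (cases b) (metis neg_equal_iff_equal)+
  qed
  then have inv: "inv onsager_map (onsager_map x) = x" for x by simp
  show ?thesis
    unfolding lie_isomorphic_def range_onsager_map[symmetric]
  proof (intro exI[of _ "inv onsager_map"] conjI ballI allI)
    show "bij_betw (inv onsager_map) (range onsager_map) UNIV"
      using \<open>inj onsager_map\<close> by (simp add: inj_imp_bij_betw_inv)
  qed (auto simp: inv simp flip: onsager_map_add onsager_map_scale onsager_map_bracket)
qed

end
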